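(* A strictly zero-dimensional biframe $M$ is congruential (i.e. isomorphic to a congruence biframe; equivalently its congruential coreflection $\chi:\mathbb{C}M_1\to M$ is an isomorphism) if and only if it has no missing clear elements, that is, for every $a\in M_1$ there is a clear element $b$ of $M$ with $\mathrm{cl}(b)=a$.
   Context: A biframe is a triple $M=(M_0,M_1,M_2)$ where $M_0$ is a frame and $M_1,M_2$ are subframes whose union generates $M_0$; a biframe homomorphism $M\to N$ is a frame homomorphism $M_0\to N_0$ mapping $M_i$ into $N_i$ for $i=1,2$. $M$ is strictly zero-dimensional if every $a\in M_1$ is complemented in $M_0$ with complement in $M_2$, and these complements generate $M_2$. Elements of $M$ means elements of $M_0$. For a frame $L$, $\mathbb{C}L$ is the frame of frame congruences on $L$ ordered by inclusion, viewed as a biframe $(\mathbb{C}L,\nabla L,\Delta L)$ (the congruence biframe of $L$), where $\nabla L=\{\nabla_a\mid a\in L\}$, $\nabla_a=\langle(0,a)\rangle$, and $\Delta L$ is the subframe generated by the congruences $\Delta_a=\langle(a,1)\rangle$. The congruential coreflection $\chi:\mathbb{C}M_1\to M$ of a strictly zero-dimensional biframe $M$ is the unique biframe homomorphism with $\chi(\nabla_a)=a$ for all $a\in M_1$. The elements of $M_1$ are called the closed elements of $M$, and for $a\in M_0$, $\mathrm{cl}(a)$ is the largest closed element below $a$. An element $a$ of $M$ is called clear if it is the largest element of $M$ with closure $\mathrm{cl}(a)$ (i.e. $\mathrm{cl}(b)=\mathrm{cl}(a)$ implies $b\le a$). *)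

theory Defs
  imports "HOL-Algebra.Complete_Lattice" "HOL-Library.FuncSet"
begin

section \<open>Frames\<close>

text \<open>
  Frames, subframes and biframes are given by carrier sets rather than types, since the lattice
  of congruences on a frame and the first part of a biframe are not types. In the locale
  \<^locale>\<open>complete_lattice\<close> the equality of the underlying \<^typ>\<open>'a gorder\<close> is HOL equality.
\<close>

locale frame = complete_lattice +
  assumes meet_sup_distrib:
    "\<lbrakk>x \<in> carrier L; A \<subseteq> carrier L\<rbrakk> \<Longrightarrow> x \<sqinter> (\<Squnion>A) = \<Squnion>((\<lambda>a. x \<sqinter> a) ` A)"

definition frame_hom :: "('a, 'c) gorder_scheme \<Rightarrow> ('b, 'd) gorder_scheme \<Rightarrow> ('a \<Rightarrow> 'b) \<Rightarrow> bool" where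
  "frame_hom L K f \<longleftrightarrow>
     f \<in> carrier L \<rightarrow> carrier K \<and> sup_pres L K f \<and> meet_pres L K f \<and> f \<top>\<^bsub>L\<^esub> = \<top>\<^bsub>K\<^esub>"

text \<open>The bottom element belongs to every subframe, as the join of the empty set.\<close>

definition subframe :: "('a, 'c) gorder_scheme \<Rightarrow> 'a set \<Rightarrow> bool" where
  "subframe L S \<longleftrightarrow> S \<subseteq> carrier L \<and> \<top>\<^bsub>L\<^esub> \<in> S \<and>
     (\<forall>x\<in>S. \<forall>y\<in>S. x \<sqinter>\<^bsub>L\<^esub> y \<in> S) \<and> (\<forall>A\<subseteq>S. \<Squnion>\<^bsub>L\<^esub>A \<in> S)"

definition subframe_generated :: "('a, 'c) gorder_scheme \<Rightarrow> 'a set \<Rightarrow> 'a set" where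
  "subframe_generated L X = \<Inter>{S. subframe L S \<and> X \<subseteq> S}"

definition is_complement :: "('a, 'c) gorder_scheme \<Rightarrow> 'a \<Rightarrow> 'a \<Rightarrow> bool" where
  "is_complement L a b \<longleftrightarrow> a \<in> carrier L \<and> b \<in> carrier L \<and>
     a \<sqinter>\<^bsub>L\<^esub> b = \<bottom>\<^bsub>L\<^esub> \<and> a \<squnion>\<^bsub>L\<^esub> b = \<top>\<^bsub>L\<^esub>"


section \<open>Biframes\<close>

text \<open>
  The total part \<open>M\<^sub>0\<close> of a biframe \<open>M\<close> is \<open>M\<close> itself, regarded as an ordered set.
\<close>

record 'a biframe = "'a gorder" +
  part1 :: "'a set"
  part2 :: "'a set"

locale biframe = frame M for M :: "'a biframe" (structure) +
  assumes subframe_part1: "subframe M (part1 M)"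
    and subframe_part2: "subframe M (part2 M)"
    and parts_generate: "subframe_generated M (part1 M \<union> part2 M) = carrier M"

definition biframe_hom :: "'a biframe \<Rightarrow> 'b biframe \<Rightarrow> ('a \<Rightarrow> 'b) \<Rightarrow> bool" where
  "biframe_hom M N f \<longleftrightarrow>
     frame_hom M N f \<and> f ` part1 M \<subseteq> part1 N \<and> f ` part2 M \<subseteq> part2 N"

definition biframe_iso :: "'a biframe \<Rightarrow> 'b biframe \<Rightarrow> ('a \<Rightarrow> 'b) \<Rightarrow> bool" where
  "biframe_iso M N f \<longleftrightarrow> biframe_hom M N f \<and>
     (\<exists>g. biframe_hom N M g \<and> (\<forall>x\<in>carrier M. g (f x) = x) \<and> (\<forall>y\<in>carrier N. f (g y) = y))"

definition biframe_isomorphic :: "'a biframe \<Rightarrow> 'b biframe \<Rightarrow> bool" where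
  "biframe_isomorphic M N \<longleftrightarrow> (\<exists>f. biframe_iso M N f)"

locale strictly_zero_dimensional_biframe = biframe +
  assumes part1_complemented: "a \<in> part1 M \<Longrightarrow> \<exists>b\<in>part2 M. is_complement M a b"
    and part2_generated: "part2 M = subframe_generated M {b. \<exists>a\<in>part1 M. is_complement M a b}"

definition closed_frame :: "'a biframe \<Rightarrow> 'a gorder" where
  "closed_frame M = \<lparr>carrier = part1 M, eq = eq M, le = le M\<rparr>"


section \<open>Congruences\<close>

text \<open>
  A frame congruence is an equivalence relation that is a subframe of \<open>L \<times> L\<close>. The set \<open>R\<close> of
  pairs below is an arbitrary family of related pairs.
\<close>

definition frame_congruence :: "('a, 'c) gorder_scheme \<Rightarrow> 'a rel \<Rightarrow> bool" where
  "frame_congruence L \<theta> \<longleftrightarrow> equiv (carrier L) \<theta> \<and>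
     (\<forall>(x, y)\<in>\<theta>. \<forall>(x', y')\<in>\<theta>. (x \<sqinter>\<^bsub>L\<^esub> x', y \<sqinter>\<^bsub>L\<^esub> y') \<in> \<theta>) \<and>
     (\<forall>R\<subseteq>\<theta>. (\<Squnion>\<^bsub>L\<^esub>(fst ` R), \<Squnion>\<^bsub>L\<^esub>(snd ` R)) \<in> \<theta>)"

definition congruence_generated :: "('a, 'c) gorder_scheme \<Rightarrow> 'a rel \<Rightarrow> 'a rel" where
  "congruence_generated L R = \<Inter>{\<theta>. frame_congruence L \<theta> \<and> R \<subseteq> \<theta>}"

definition nabla :: "('a, 'c) gorder_scheme \<Rightarrow> 'a \<Rightarrow> 'a rel" where
  "nabla L a = congruence_generated L {(\<bottom>\<^bsub>L\<^esub>, a)}"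

definition delta :: "('a, 'c) gorder_scheme \<Rightarrow> 'a \<Rightarrow> 'a rel" where
  "delta L a = congruence_generated L {(a, \<top>\<^bsub>L\<^esub>)}"

definition congruence_frame :: "('a, 'c) gorder_scheme \<Rightarrow> 'a rel gorder" where
  "congruence_frame L = \<lparr>carrier = {\<theta>. frame_congruence L \<theta>}, eq = (=), le = (\<subseteq>)\<rparr>"

definition congruence_biframe :: "('a, 'c) gorder_scheme \<Rightarrow> 'a rel biframe" where
  "congruence_biframe L =
     \<lparr>carrier = carrier (congruence_frame L),
      eq = eq (congruence_frame L),
      le = le (congruence_frame L),
      part1 = nabla L ` carrier L,
      part2 = subframe_generated (congruence_frame L) (delta L ` carrier L)\<rparr>"


section \<open>Congruential biframes and the congruential coreflection\<close>

text \<open>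
  HOL cannot quantify over types inside a formula, so \<open>L\<close> ranges here over the frames on subsets
  of \<^typ>\<open>'a\<close>. This loses no generality: an isomorphism from \<open>M\<close> onto the congruence biframe of a
  frame \<open>L\<close> on another type makes \<open>L\<close> isomorphic to the closed elements of \<open>M\<close>.
\<close>

definition congruential :: "'a biframe \<Rightarrow> bool" where
  "congruential M \<longleftrightarrow>
     (\<exists>L :: 'a gorder. frame L \<and> biframe_isomorphic M (congruence_biframe L))"

text \<open>
  HOL functions are total, so uniqueness of the coreflection requires fixing its values outside
  the carrier of the congruence biframe; \<^const>\<open>extensional\<close> does this.
\<close>

definition congruential_coreflection :: "'a biframe \<Rightarrow> 'a rel \<Rightarrow> 'a" where
  "congruential_coreflection M =
     (THE \<chi>. \<chi> \<in> extensional (carrier (congruence_biframe (closed_frame M))) \<and>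
        biframe_hom (congruence_biframe (closed_frame M)) M \<chi> \<and>
        (\<forall>a\<in>part1 M. \<chi> (nabla (closed_frame M) a) = a))"


section \<open>Closure and clear elements\<close>

definition cl :: "'a biframe \<Rightarrow> 'a \<Rightarrow> 'a" where
  "cl M a = (THE c. greatest M c {x \<in> part1 M. x \<sqsubseteq>\<^bsub>M\<^esub> a})"

definition clear :: "'a biframe \<Rightarrow> 'a \<Rightarrow> bool" where
  "clear M a \<longleftrightarrow> greatest M a {b \<in> carrier M. cl M b = cl M a}"

definition no_missing_clear_elements :: "'a biframe \<Rightarrow> bool" where
  "no_missing_clear_elements M \<longleftrightarrow> (\<forall>a\<in>part1 M. \<exists>b. clear M b \<and> cl M b = a)"

end

theory Submission
  imports Defs
begin

text \<open>
  Let \<open>K\<close> be the frame of closed elements of \<open>M\<close>. Each \<open>m\<close> in \<open>M\<close> leaves a trace on \<open>K\<close>, the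
  congruence that relates \<open>x\<close> and \<open>y\<close> when \<open>x \<squnion> m = y \<squnion> m\<close>. The coreflection is the left adjoint of
  the trace, \<open>\<theta> \<mapsto> \<Squnion>{b \<sqinter> a\<^sup>c | (a, b) \<in> \<theta>}\<close>: since \<open>b \<sqinter> a\<^sup>c \<sqsubseteq> m\<close> means \<open>b \<sqsubseteq> a \<squnion> m\<close>, it
  satisfies \<open>\<chi> \<theta> \<sqsubseteq> m \<longleftrightarrow> \<theta> \<subseteq> trace m\<close> (\<open>coreflection_le_iff\<close>). Preservation of joins is then
  automatic, the explicit formula gives preservation of binary meets, and uniqueness follows because
  every congruence is the join of the \<open>\<nabla>\<^sub>b \<inter> \<Delta>\<^sub>a\<close> with \<open>(a, b) \<in> \<theta>\<close> and \<open>\<Delta>\<^sub>a\<close> must go to the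
  complement of \<open>a\<close>. This \<open>\<chi>\<close> is always onto, as its image is a subframe that contains both parts of
  \<open>M\<close>. So the question is when it is injective.

  The congruence frame of any frame has all clear elements. The one with closure \<open>\<nabla>\<^sub>a\<close> is the
  congruence that relates \<open>x\<close> and \<open>y\<close> when \<open>x \<sqinter> z \<sqsubseteq> a \<longleftrightarrow> y \<sqinter> z \<sqsubseteq> a\<close> for all \<open>z\<close>; it is called
  \<open>dense_congruence a\<close> below, because it corresponds to the smallest dense sublocale of the closed
  sublocale given by \<open>a\<close>. A biframe isomorphism carries clear elements back to \<open>M\<close>, whence the forward
  direction (\<open>isomorphic_congruence_biframe_clear\<close>).

  Conversely, these congruences determine all others: \<open>\<theta>\<close> lies below \<open>dense_congruence a\<close> exactly
  when \<open>a\<close> is the largest element of its \<open>\<theta>\<close>-class, and \<open>\<theta>\<close> is recovered from the largest elements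
  of its classes (\<open>dense_congruences_separate\<close>). If \<open>c\<close> is a clear element of \<open>M\<close> with closure \<open>a\<close>,
  then \<open>\<chi> \<theta> \<sqsubseteq> c \<longleftrightarrow> \<theta> \<subseteq> dense_congruence a\<close> (\<open>coreflection_le_clear_iff\<close>). Hence, when no clear
  element is missing, \<open>\<chi> \<theta>\<close> determines which of the \<open>dense_congruence a\<close> lie above \<open>\<theta>\<close>, and so
  determines \<open>\<theta>\<close>.
\<close>

section \<open>Order and distributivity in frames\<close>

context complete_lattice
begin

lemma sup_eqI:
  assumes "A \<subseteq> carrier L" "s \<in> carrier L" "\<And>x. x \<in> A \<Longrightarrow> x \<sqsubseteq> s"
    and "\<And>u. u \<in> carrier L \<Longrightarrow> (\<And>x. x \<in> A \<Longrightarrow> x \<sqsubseteq> u) \<Longrightarrow> s \<sqsubseteq> u"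
  shows "\<Squnion>A = s"
proof (rule le_antisym)
  show "\<Squnion>A \<sqsubseteq> s"
    using assms(1-3) by (intro sup_least)
  show "s \<sqsubseteq> \<Squnion>A"
    using assms(1) by (intro assms(4) sup_upper) auto
qed (use assms in auto)

lemma sup_le_iff:
  assumes "A \<subseteq> carrier L" "u \<in> carrier L"
  shows "\<Squnion>A \<sqsubseteq> u \<longleftrightarrow> (\<forall>x\<in>A. x \<sqsubseteq> u)"
  using assms by (meson le_trans sup_closed sup_least sup_upper subsetD)

lemma join_le_iff:
  assumes "x \<in> carrier L" "y \<in> carrier L" "u \<in> carrier L"
  shows "x \<squnion> y \<sqsubseteq> u \<longleftrightarrow> x \<sqsubseteq> u \<and> y \<sqsubseteq> u"
  using sup_le_iff[of "{x, y}" u] assms by (auto simp: join_def)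

lemma le_meet_iff:
  assumes "x \<in> carrier L" "y \<in> carrier L" "u \<in> carrier L"
  shows "u \<sqsubseteq> x \<sqinter> y \<longleftrightarrow> u \<sqsubseteq> x \<and> u \<sqsubseteq> y"
  using assms by (meson le_trans meet_closed meet_le meet_left meet_right)

lemma meet_eqI:
  assumes "x \<in> carrier L" "y \<in> carrier L" "s \<in> carrier L" "s \<sqsubseteq> x" "s \<sqsubseteq> y"
    and "\<And>u. u \<in> carrier L \<Longrightarrow> u \<sqsubseteq> x \<Longrightarrow> u \<sqsubseteq> y \<Longrightarrow> u \<sqsubseteq> s"
  shows "x \<sqinter> y = s"
proof (rule le_antisym)
  show "x \<sqinter> y \<sqsubseteq> s"
    using assms(1,2) by (intro assms(6) meet_left meet_right) auto
  show "s \<sqsubseteq> x \<sqinter> y"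
    using assms(1-5) by (intro meet_le)
qed (use assms in auto)

lemma top_eqI: "t \<in> carrier L \<Longrightarrow> (\<And>x. x \<in> carrier L \<Longrightarrow> x \<sqsubseteq> t) \<Longrightarrow> \<top> = t"
  by (intro le_antisym) auto

lemma bottom_eqI: "b \<in> carrier L \<Longrightarrow> (\<And>x. x \<in> carrier L \<Longrightarrow> b \<sqsubseteq> x) \<Longrightarrow> \<bottom> = b"
  by (intro le_antisym) auto

lemma bottom_eq_sup: "\<bottom> = \<Squnion>{}"
proof -
  have "\<Squnion>{} = \<bottom>"
    by (rule sup_eqI) auto
  then show ?thesis by simp
qed

lemma meet_eq_left: "x \<in> carrier L \<Longrightarrow> y \<in> carrier L \<Longrightarrow> x \<sqsubseteq> y \<Longrightarrow> x \<sqinter> y = x"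
  by (rule meet_eqI) auto

lemma meet_mono:
  assumes "x \<sqsubseteq> x'" "y \<sqsubseteq> y'"
    and "x \<in> carrier L" "x' \<in> carrier L" "y \<in> carrier L" "y' \<in> carrier L"
  shows "x \<sqinter> y \<sqsubseteq> x' \<sqinter> y'"
  using assms by (meson le_trans meet_closed meet_le meet_left meet_right)

lemma subframe_carrier: "subframe L (carrier L)"
  by (simp add: subframe_def)

lemma subframe_subframe_generated:
  assumes "X \<subseteq> carrier L"
  shows "subframe L (subframe_generated L X)"
proof -
  have "carrier L \<in> {S. subframe L S \<and> X \<subseteq> S}"
    using assms subframe_carrier by simp
  then have "subframe_generated L X \<subseteq> carrier L"
    unfolding subframe_generated_def by (rule Inter_lower)
  moreover have "\<Squnion>A \<in> subframe_generated L X" if "A \<subseteq> subframe_generated L X" for A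
    using that unfolding subframe_generated_def subframe_def by blast
  ultimately show ?thesis
    by (auto simp: subframe_def subframe_generated_def)
qed

end

lemma subframe_generated_base: "X \<subseteq> subframe_generated L X"
  by (auto simp: subframe_generated_def)

lemma subframe_generated_least: "subframe L S \<Longrightarrow> X \<subseteq> S \<Longrightarrow> subframe_generated L X \<subseteq> S"
  by (auto simp: subframe_generated_def)

context frame
begin

lemma sup_meet_le_iff:
  assumes "A \<subseteq> carrier L" "z \<in> carrier L" "u \<in> carrier L"
  shows "\<Squnion>A \<sqinter> z \<sqsubseteq> u \<longleftrightarrow> (\<forall>x\<in>A. x \<sqinter> z \<sqsubseteq> u)"
proof -
  have "\<Squnion>A \<sqinter> z = \<Squnion>((\<lambda>a. z \<sqinter> a) ` A)"
    using meet_sup_distrib[of z A] assms by (simp add: meet_comm[of L "\<Squnion>A"])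
  moreover have "(\<lambda>a. z \<sqinter> a) ` A \<subseteq> carrier L"
    using assms by auto
  ultimately show ?thesis
    using assms by (simp add: sup_le_iff meet_comm[of L z])
qed

lemma join_meet_le_iff:
  assumes "x \<in> carrier L" "y \<in> carrier L" "z \<in> carrier L" "u \<in> carrier L"
  shows "(x \<squnion> y) \<sqinter> z \<sqsubseteq> u \<longleftrightarrow> x \<sqinter> z \<sqsubseteq> u \<and> y \<sqinter> z \<sqsubseteq> u"
  using sup_meet_le_iff[of "{x, y}" z u] assms by (auto simp: join_def)

text \<open>
  This turns the joinands \<open>b \<sqinter> a\<^sup>c\<close> of the coreflection into conditions on the pair \<open>(a, b)\<close>.
\<close>

lemma complement_shunt:
  assumes c: "is_complement L a a'" and b: "b \<in> carrier L" and m: "m \<in> carrier L"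
  shows "b \<sqinter> a' \<sqsubseteq> m \<longleftrightarrow> b \<sqsubseteq> a \<squnion> m"
proof -
  have a: "a \<in> carrier L" "a' \<in> carrier L" "a \<sqinter> a' = \<bottom>" "a \<squnion> a' = \<top>"
    using c by (auto simp: is_complement_def)
  show ?thesis
  proof
    assume *: "b \<sqinter> a' \<sqsubseteq> m"
    have "(a \<squnion> a') \<sqinter> b \<sqsubseteq> a \<squnion> m"
      unfolding join_meet_le_iff[OF a(1,2) b join_closed[OF a(1) m]]
      using * a b m le_trans[OF meet_left join_left, of a b m]
        le_trans[OF * join_right[of a m]] by (simp add: meet_comm[of L a'])
    then show "b \<sqsubseteq> a \<squnion> m"
      using a b by (simp add: meet_comm[of L "\<top>"] meet_eq_left)
  next
    assume *: "b \<sqsubseteq> a \<squnion> m"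
    have "b \<sqinter> a' \<sqsubseteq> (a \<squnion> m) \<sqinter> a'"
      using * a b m by (intro meet_mono) auto
    moreover have "(a \<squnion> m) \<sqinter> a' \<sqsubseteq> m"
      using a m by (simp add: join_meet_le_iff meet_left)
    ultimately show "b \<sqinter> a' \<sqsubseteq> m"
      using a b m by (meson le_trans meet_closed join_closed)
  qed
qed

lemma complement_unique:
  assumes "is_complement L a b" "is_complement L a c"
  shows "b = c"
proof -
  have "b' \<sqsubseteq> c'" if "is_complement L a b'" "is_complement L a c'" for b' c'
  proof -
    have "b' \<sqinter> \<top> \<sqsubseteq> c'" if "b' \<in> carrier L" "c' \<in> carrier L" "b' \<sqsubseteq> a \<squnion> c'"
    proof -
      have "\<top> \<sqinter> b' \<sqsubseteq> c'"
        using complement_shunt[OF \<open>is_complement L a b'\<close>, of \<top> c'] that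
          \<open>is_complement L a c'\<close> by (simp add: is_complement_def)
      then show ?thesis by (simp add: meet_comm[of L b'])
    qed
    then show ?thesis
      using that by (auto simp: is_complement_def meet_eq_left)
  qed
  then show ?thesis
    using assms by (intro le_antisym) (auto simp: is_complement_def)
qed

end

section \<open>Congruences of a frame\<close>

context frame
begin

lemma frame_congruenceD:
  assumes "frame_congruence L \<theta>"
  shows "(x, y) \<in> \<theta> \<Longrightarrow> x \<in> carrier L" "(x, y) \<in> \<theta> \<Longrightarrow> y \<in> carrier L"
    and "x \<in> carrier L \<Longrightarrow> (x, x) \<in> \<theta>"
    and "(x, y) \<in> \<theta> \<Longrightarrow> (y, x) \<in> \<theta>"
    and "(x, y) \<in> \<theta> \<Longrightarrow> (y, z) \<in> \<theta> \<Longrightarrow> (x, z) \<in> \<theta>"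
    and "(x, y) \<in> \<theta> \<Longrightarrow> (x', y') \<in> \<theta> \<Longrightarrow> (x \<sqinter> x', y \<sqinter> y') \<in> \<theta>"
    and "(x, y) \<in> \<theta> \<Longrightarrow> (x', y') \<in> \<theta> \<Longrightarrow> (x \<squnion> x', y \<squnion> y') \<in> \<theta>"
    and "R \<subseteq> \<theta> \<Longrightarrow> (\<Squnion>(fst ` R), \<Squnion>(snd ` R)) \<in> \<theta>"
proof -
  have e: "equiv (carrier L) \<theta>"
    and m: "\<And>x y x' y'. (x, y) \<in> \<theta> \<Longrightarrow> (x', y') \<in> \<theta> \<Longrightarrow> (x \<sqinter> x', y \<sqinter> y') \<in> \<theta>"
    and s: "\<And>R. R \<subseteq> \<theta> \<Longrightarrow> (\<Squnion>(fst ` R), \<Squnion>(snd ` R)) \<in> \<theta>"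
    using assms by (auto simp: frame_congruence_def)
  show "(x, y) \<in> \<theta> \<Longrightarrow> x \<in> carrier L" "(x, y) \<in> \<theta> \<Longrightarrow> y \<in> carrier L"
    "x \<in> carrier L \<Longrightarrow> (x, x) \<in> \<theta>"
    using e by (auto simp: equiv_def refl_on_def)
  show "(x, y) \<in> \<theta> \<Longrightarrow> (y, x) \<in> \<theta>" "(x, y) \<in> \<theta> \<Longrightarrow> (y, z) \<in> \<theta> \<Longrightarrow> (x, z) \<in> \<theta>"
    using e unfolding equiv_def by (meson symD transD)+
  show "(x, y) \<in> \<theta> \<Longrightarrow> (x', y') \<in> \<theta> \<Longrightarrow> (x \<sqinter> x', y \<sqinter> y') \<in> \<theta>"
    "R \<subseteq> \<theta> \<Longrightarrow> (\<Squnion>(fst ` R), \<Squnion>(snd ` R)) \<in> \<theta>"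
    using m s by auto
  show "(x, y) \<in> \<theta> \<Longrightarrow> (x', y') \<in> \<theta> \<Longrightarrow> (x \<squnion> x', y \<squnion> y') \<in> \<theta>"
    using s[of "{(x, y), (x', y')}"] by (auto simp: join_def)
qed

text \<open>
  The closed, open and dense congruences are symmetric parts of preorders that contain the order.
  Compatibility with meets and joins then only has to be checked in one argument at a time.
\<close>

lemma frame_congruence_of_preorder:
  fixes P
  defines "\<theta> \<equiv> {(x, y). x \<in> carrier L \<and> y \<in> carrier L \<and> P x y \<and> P y x}"
  assumes le: "\<And>x y. x \<in> carrier L \<Longrightarrow> y \<in> carrier L \<Longrightarrow> x \<sqsubseteq> y \<Longrightarrow> P x y"
    and trans: "\<And>x y z. x \<in> carrier L \<Longrightarrow> y \<in> carrier L \<Longrightarrow> z \<in> carrier L \<Longrightarrow>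
      P x y \<Longrightarrow> P y z \<Longrightarrow> P x z"
    and meet: "\<And>x y z. x \<in> carrier L \<Longrightarrow> y \<in> carrier L \<Longrightarrow> z \<in> carrier L \<Longrightarrow>
      P x y \<Longrightarrow> P (x \<sqinter> z) (y \<sqinter> z)"
    and sup: "\<And>A y. A \<subseteq> carrier L \<Longrightarrow> y \<in> carrier L \<Longrightarrow> (\<And>x. x \<in> A \<Longrightarrow> P x y) \<Longrightarrow> P (\<Squnion>A) y"
  shows "frame_congruence L \<theta>"
proof -
  have meets: "P (x \<sqinter> x') (y \<sqinter> y')"
    if "x \<in> carrier L" "y \<in> carrier L" "x' \<in> carrier L" "y' \<in> carrier L" "P x y" "P x' y'"
    for x y x' y'
  proof (rule trans)
    show "P (x \<sqinter> x') (y \<sqinter> x')"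
      using meet that by blast
    show "P (y \<sqinter> x') (y \<sqinter> y')"
      using meet[of x' y' y] that by (simp add: meet_comm[of L y])
  qed (use that in auto)
  have sups: "P (\<Squnion>A) (\<Squnion>B)"
    if "A \<subseteq> carrier L" "B \<subseteq> carrier L" "\<And>x. x \<in> A \<Longrightarrow> \<exists>y\<in>B. P x y" for A B
  proof (rule sup)
    fix x assume "x \<in> A"
    then obtain y where y: "y \<in> B" "P x y"
      using \<open>\<And>x. x \<in> A \<Longrightarrow> \<exists>y\<in>B. P x y\<close> by blast
    then have "P y (\<Squnion>B)"
      using that by (auto intro!: le sup_upper)
    then show "P x (\<Squnion>B)"
      using y that \<open>x \<in> A\<close> by (auto intro: trans[of x y])
  qed (use that in auto)
  have "equiv (carrier L) \<theta>"
    unfolding equiv_def refl_on_def \<theta>_def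
    by (auto simp: sym_def trans_def intro: le trans)
  moreover have "\<forall>(x, y)\<in>\<theta>. \<forall>(x', y')\<in>\<theta>. (x \<sqinter> x', y \<sqinter> y') \<in> \<theta>"
    by (auto simp: \<theta>_def intro: meets)
  moreover have "(\<Squnion>(fst ` R), \<Squnion>(snd ` R)) \<in> \<theta>" if "R \<subseteq> \<theta>" for R
  proof -
    have "fst ` R \<subseteq> carrier L" "snd ` R \<subseteq> carrier L"
      using that by (auto simp: \<theta>_def)
    moreover have "\<exists>y\<in>snd ` R. P x y" if "x \<in> fst ` R" for x
      using that \<open>R \<subseteq> \<theta>\<close> by (force simp: \<theta>_def)
    moreover have "\<exists>x\<in>fst ` R. P y x" if "y \<in> snd ` R" for y
      using that \<open>R \<subseteq> \<theta>\<close> by (force simp: \<theta>_def)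
    ultimately show ?thesis
      by (simp add: \<theta>_def sups del: bex_simps Set.bex_simps image_iff)
  qed
  ultimately show ?thesis
    by (simp add: frame_congruence_def)
qed

text \<open>
  Explicit forms of \<open>\<nabla>\<^sub>a\<close> (equality of joins with \<open>a\<close>) and \<open>\<Delta>\<^sub>a\<close> (equality of meets with \<open>a\<close>),
  written with inequalities so that they are symmetric parts of preorders.
\<close>

definition closed_congruence :: "'a \<Rightarrow> 'a rel" where
  "closed_congruence a =
    {(x, y). x \<in> carrier L \<and> y \<in> carrier L \<and> x \<sqsubseteq> y \<squnion> a \<and> y \<sqsubseteq> x \<squnion> a}"

definition open_congruence :: "'a \<Rightarrow> 'a rel" where
  "open_congruence a =
    {(x, y). x \<in> carrier L \<and> y \<in> carrier L \<and> x \<sqinter> a \<sqsubseteq> y \<and> y \<sqinter> a \<sqsubseteq> x}"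

text \<open>
  Equivalently, \<open>x\<close> and \<open>y\<close> have the same Heyting implication into \<open>a\<close>.
\<close>

definition dense_congruence :: "'a \<Rightarrow> 'a rel" where
  "dense_congruence a =
    {(x, y). x \<in> carrier L \<and> y \<in> carrier L \<and>
      (\<forall>z\<in>carrier L. y \<sqinter> z \<sqsubseteq> a \<longrightarrow> x \<sqinter> z \<sqsubseteq> a) \<and> (\<forall>z\<in>carrier L. x \<sqinter> z \<sqsubseteq> a \<longrightarrow> y \<sqinter> z \<sqsubseteq> a)}"

lemma frame_congruence_closed:
  assumes a: "a \<in> carrier L"
  shows "frame_congruence L (closed_congruence a)"
  unfolding closed_congruence_def
proof (rule frame_congruence_of_preorder)
  fix x y z assume c: "x \<in> carrier L" "y \<in> carrier L" "z \<in> carrier L"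
  show "x \<sqsubseteq> z \<squnion> a" if "x \<sqsubseteq> y \<squnion> a" "y \<sqsubseteq> z \<squnion> a"
  proof -
    have "y \<squnion> a \<sqsubseteq> z \<squnion> a"
      using that c a by (simp add: join_le_iff join_right)
    then show ?thesis using that c a by (meson le_trans join_closed)
  qed
  show "x \<sqinter> z \<sqsubseteq> y \<sqinter> z \<squnion> a" if "x \<sqsubseteq> y \<squnion> a"
  proof -
    have "(y \<squnion> a) \<sqinter> z \<sqsubseteq> y \<sqinter> z \<squnion> a"
      using c a by (simp add: join_meet_le_iff join_left) (meson le_trans meet_left join_right meet_closed join_closed)
    moreover have "x \<sqinter> z \<sqsubseteq> (y \<squnion> a) \<sqinter> z"
      using that c a by (intro meet_mono) auto
    ultimately show ?thesis using c a by (meson le_trans join_closed meet_closed)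
  qed
next
  fix x y assume "x \<in> carrier L" "y \<in> carrier L" "x \<sqsubseteq> y"
  then show "x \<sqsubseteq> y \<squnion> a" using a by (meson le_trans join_left join_closed)
qed (use a in \<open>auto intro: sup_least\<close>)

lemma frame_congruence_open:
  assumes a: "a \<in> carrier L"
  shows "frame_congruence L (open_congruence a)"
  unfolding open_congruence_def
proof (rule frame_congruence_of_preorder)
  fix x y z assume c: "x \<in> carrier L" "y \<in> carrier L" "z \<in> carrier L"
  show "x \<sqinter> a \<sqsubseteq> z" if "x \<sqinter> a \<sqsubseteq> y" "y \<sqinter> a \<sqsubseteq> z"
  proof -
    have "x \<sqinter> a \<sqsubseteq> y \<sqinter> a"
      using that c a by (simp add: le_meet_iff meet_right)
    then show ?thesis using that c a by (meson le_trans meet_closed)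
  qed
  show "x \<sqinter> z \<sqinter> a \<sqsubseteq> y \<sqinter> z" if "x \<sqinter> a \<sqsubseteq> y"
  proof -
    have "x \<sqinter> z \<sqinter> a \<sqsubseteq> x \<sqinter> a"
      using c a by (intro meet_mono meet_left) auto
    moreover have "x \<sqinter> z \<sqinter> a \<sqsubseteq> z"
      using c a by (meson le_trans meet_left meet_right meet_closed)
    ultimately show ?thesis
      using that c a le_trans[of "x \<sqinter> z \<sqinter> a" "x \<sqinter> a" y] by (simp add: le_meet_iff)
  qed
next
  fix x y assume "x \<in> carrier L" "y \<in> carrier L" "x \<sqsubseteq> y"
  then show "x \<sqinter> a \<sqsubseteq> y" using a by (meson le_trans meet_left meet_closed)
qed (use a in \<open>auto simp: sup_meet_le_iff\<close>)

lemma frame_congruence_dense: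
  assumes a: "a \<in> carrier L"
  shows "frame_congruence L (dense_congruence a)"
  unfolding dense_congruence_def
proof (rule frame_congruence_of_preorder)
  fix x y assume "x \<in> carrier L" "y \<in> carrier L" "x \<sqsubseteq> y"
  then show "\<forall>z\<in>carrier L. y \<sqinter> z \<sqsubseteq> a \<longrightarrow> x \<sqinter> z \<sqsubseteq> a"
    using a by (meson le_trans meet_mono le_refl meet_closed)
qed (use a in \<open>auto simp: sup_meet_le_iff meet_assoc\<close>)

lemma nabla_eq_closed_congruence:
  assumes a: "a \<in> carrier L"
  shows "nabla L a = closed_congruence a"
proof
  have "{(\<bottom>, a)} \<subseteq> closed_congruence a"
    using a by (simp add: closed_congruence_def join_right)
  then show "nabla L a \<subseteq> closed_congruence a"
    unfolding nabla_def congruence_generated_def using frame_congruence_closed[OF a] by blast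
next
  have "closed_congruence a \<subseteq> \<theta>" if \<theta>: "frame_congruence L \<theta>" "(\<bottom>, a) \<in> \<theta>" for \<theta>
  proof clarify
    fix x y assume "(x, y) \<in> closed_congruence a"
    then have xy: "x \<in> carrier L" "y \<in> carrier L" "x \<sqsubseteq> y \<squnion> a" "y \<sqsubseteq> x \<squnion> a"
      by (auto simp: closed_congruence_def)
    have "(x, x \<squnion> a) \<in> \<theta>" if "x \<in> carrier L" for x
    proof -
      have "x \<squnion> \<bottom> = x" using that by (intro le_antisym) (simp_all add: join_le_iff join_left)
      then show ?thesis
        using frame_congruenceD(7)[OF \<theta>(1) frame_congruenceD(3)[OF \<theta>(1) that] \<theta>(2)] by simp
    qed
    moreover have "x \<squnion> a = y \<squnion> a"
      using xy a by (intro le_antisym) (auto simp: join_le_iff join_right)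
    ultimately show "(x, y) \<in> \<theta>"
      using xy frame_congruenceD(4,5)[OF \<theta>(1)] by metis
  qed
  then show "closed_congruence a \<subseteq> nabla L a"
    by (auto simp: nabla_def congruence_generated_def)
qed

lemma delta_eq_open_congruence:
  assumes a: "a \<in> carrier L"
  shows "delta L a = open_congruence a"
proof
  have "{(a, \<top>)} \<subseteq> open_congruence a"
    using a by (simp add: open_congruence_def meet_right)
  then show "delta L a \<subseteq> open_congruence a"
    unfolding delta_def congruence_generated_def using frame_congruence_open[OF a] by blast
next
  have "open_congruence a \<subseteq> \<theta>" if \<theta>: "frame_congruence L \<theta>" "(a, \<top>) \<in> \<theta>" for \<theta>
  proof clarify
    fix x y assume "(x, y) \<in> open_congruence a"
    then have xy: "x \<in> carrier L" "y \<in> carrier L" "x \<sqinter> a \<sqsubseteq> y" "y \<sqinter> a \<sqsubseteq> x"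
      by (auto simp: open_congruence_def)
    have "(x \<sqinter> a, x) \<in> \<theta>" if "x \<in> carrier L" for x
      using frame_congruenceD(6)[OF \<theta>(1) frame_congruenceD(3)[OF \<theta>(1) that] \<theta>(2)] that
      by (simp add: meet_eq_left)
    moreover have "x \<sqinter> a = y \<sqinter> a"
      using xy a by (intro le_antisym) (auto simp: le_meet_iff meet_right)
    ultimately show "(x, y) \<in> \<theta>"
      using xy frame_congruenceD(4,5)[OF \<theta>(1)] by metis
  qed
  then show "open_congruence a \<subseteq> delta L a"
    by (auto simp: delta_def congruence_generated_def)
qed

lemma nabla_subset_iff:
  assumes "frame_congruence L \<theta>" "a \<in> carrier L"
  shows "nabla L a \<subseteq> \<theta> \<longleftrightarrow> (\<bottom>, a) \<in> \<theta>"
  using assms by (auto simp: nabla_def congruence_generated_def)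

lemma bottom_class_downward:
  assumes \<theta>: "frame_congruence L \<theta>" and "(\<bottom>, a) \<in> \<theta>" "b \<in> carrier L" "b \<sqsubseteq> a"
  shows "(\<bottom>, b) \<in> \<theta>"
proof -
  have "a \<in> carrier L" using frame_congruenceD(2)[OF \<theta>] assms by blast
  moreover have "(b \<sqinter> \<bottom>, b \<sqinter> a) \<in> \<theta>"
    using assms frame_congruenceD(3,6)[OF \<theta>] by blast
  moreover have "b \<sqinter> \<bottom> = \<bottom>"
    using assms by (simp add: meet_comm[of L b] meet_eq_left)
  ultimately show ?thesis
    using assms by (simp add: meet_eq_left)
qed

lemma nabla_subset_nabla_iff:
  assumes "a \<in> carrier L" "b \<in> carrier L"
  shows "nabla L a \<subseteq> nabla L b \<longleftrightarrow> a \<sqsubseteq> b"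
proof -
  have "\<bottom> \<squnion> b = b" using assms by (intro le_antisym) (simp_all add: join_le_iff join_right)
  then show ?thesis
    using assms frame_congruence_closed[of b]
    by (simp add: nabla_subset_iff nabla_eq_closed_congruence[of b])
       (simp add: closed_congruence_def)
qed

text \<open>In the congruence biframe this makes \<open>\<nabla>\<^sub>a\<close> the closure of \<open>dense_congruence a\<close>.\<close>

lemma bottom_dense_congruence_iff:
  assumes a: "a \<in> carrier L" and b: "b \<in> carrier L"
  shows "(\<bottom>, b) \<in> dense_congruence a \<longleftrightarrow> b \<sqsubseteq> a"
proof
  assume "(\<bottom>, b) \<in> dense_congruence a"
  moreover have "\<bottom> \<sqinter> \<top> \<sqsubseteq> a" using a by (simp add: meet_eq_left)
  ultimately have "b \<sqinter> \<top> \<sqsubseteq> a"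
    unfolding dense_congruence_def by blast
  then show "b \<sqsubseteq> a" using b by (simp add: meet_eq_left)
next
  assume "b \<sqsubseteq> a"
  then have "\<bottom> \<sqinter> z \<sqsubseteq> a" "b \<sqinter> z \<sqsubseteq> a" if "z \<in> carrier L" for z
    using a b that by (meson le_trans meet_left meet_closed bottom_closed bottom_lower)+
  then show "(\<bottom>, b) \<in> dense_congruence a"
    using a b by (simp add: dense_congruence_def)
qed

text \<open>
  The condition on \<open>\<theta>\<close> says that \<open>{x. x \<sqsubseteq> a}\<close> is a union of \<open>\<theta>\<close>-classes. As \<open>\<theta>\<close> is stable under
  meets with any \<open>z\<close>, it extends to the condition on all \<open>x \<sqinter> z\<close>.
\<close>

lemma subset_dense_congruenceI:
  assumes \<theta>: "frame_congruence L \<theta>" and a: "a \<in> carrier L"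
    and imp: "\<And>p q. (p, q) \<in> \<theta> \<Longrightarrow> q \<sqsubseteq> a \<Longrightarrow> p \<sqsubseteq> a"
  shows "\<theta> \<subseteq> dense_congruence a"
proof -
  have "x \<sqinter> z \<sqsubseteq> a" if "(x, y) \<in> \<theta>" "z \<in> carrier L" "y \<sqinter> z \<sqsubseteq> a" for x y z
    using imp[of "x \<sqinter> z" "y \<sqinter> z"] that frame_congruenceD(3,6)[OF \<theta>] by blast
  then show ?thesis
    unfolding dense_congruence_def using frame_congruenceD(1,2,4)[OF \<theta>] by blast
qed

text \<open>
  The largest element \<open>n\<close> of the \<open>\<theta>\<close>-class of \<open>x\<close> satisfies \<open>\<theta> \<subseteq> dense_congruence n\<close>. If also
  \<open>\<phi> \<subseteq> dense_congruence n\<close> and \<open>(x, y) \<in> \<phi>\<close>, then \<open>x \<sqsubseteq> n\<close> forces \<open>y \<sqsubseteq> n\<close>, and meeting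
  \<open>(x, n) \<in> \<theta>\<close> with \<open>y\<close> gives \<open>(x \<sqinter> y, y) \<in> \<theta>\<close>.
\<close>

lemma dense_congruences_separate:
  assumes \<theta>: "frame_congruence L \<theta>" and \<phi>: "frame_congruence L \<phi>"
    and sub: "\<And>a. a \<in> carrier L \<Longrightarrow> \<theta> \<subseteq> dense_congruence a \<Longrightarrow> \<phi> \<subseteq> dense_congruence a"
  shows "\<phi> \<subseteq> \<theta>"
proof clarify
  note D = frame_congruenceD[OF \<theta>]
  have step: "(x \<sqinter> y, y) \<in> \<theta>" if xy: "(x, y) \<in> \<phi>" for x y
  proof -
    have c: "x \<in> carrier L" "y \<in> carrier L"
      using frame_congruenceD(1,2)[OF \<phi> xy] .
    define n where "n = \<Squnion>{u. (x, u) \<in> \<theta>}"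
    have cls: "{u. (x, u) \<in> \<theta>} \<subseteq> carrier L"
      using D(2) by blast
    then have n: "n \<in> carrier L" by (simp add: n_def)
    have "(\<Squnion>(fst ` ({x} \<times> {u. (x, u) \<in> \<theta>})), \<Squnion>(snd ` ({x} \<times> {u. (x, u) \<in> \<theta>}))) \<in> \<theta>"
      by (rule D(8)) auto
    moreover have "fst ` ({x} \<times> {u. (x, u) \<in> \<theta>}) = {x}"
      using D(3)[OF c(1)] by force
    moreover have "snd ` ({x} \<times> {u. (x, u) \<in> \<theta>}) = {u. (x, u) \<in> \<theta>}"
      by force
    ultimately have xn: "(x, n) \<in> \<theta>"
      using c by (simp add: n_def)
    have "\<theta> \<subseteq> dense_congruence n"
    proof (rule subset_dense_congruenceI[OF \<theta> n])
      fix p q assume pq: "(p, q) \<in> \<theta>" "q \<sqsubseteq> n"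
      then have pc: "p \<in> carrier L" "q \<in> carrier L" using D by blast+
      have "(p \<squnion> n, q \<squnion> n) \<in> \<theta>" using D(7)[OF pq(1) D(3)[OF n]] .
      moreover have "q \<squnion> n = n"
        using pq pc n by (intro le_antisym) (auto simp: join_le_iff join_right)
      ultimately have "(x, p \<squnion> n) \<in> \<theta>" using D(4,5) xn by metis
      then have "p \<squnion> n \<sqsubseteq> n"
        using cls by (simp add: sup_upper n_def)
      then show "p \<sqsubseteq> n" using pc n by (simp add: join_le_iff)
    qed
    then have "(x, y) \<in> dense_congruence n"
      using sub n xy by blast
    moreover have "x \<sqinter> \<top> \<sqsubseteq> n"
      using cls D(3)[OF c(1)] c by (simp add: meet_eq_left n_def sup_upper)
    ultimately have "y \<sqinter> \<top> \<sqsubseteq> n"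
      by (auto simp: dense_congruence_def)
    then have "y \<sqsubseteq> n" using c by (simp add: meet_eq_left)
    moreover have "(x \<sqinter> y, n \<sqinter> y) \<in> \<theta>"
      using D(6)[OF xn D(3)[OF c(2)]] .
    ultimately show ?thesis
      using c n by (simp add: meet_comm[of L n] meet_eq_left)
  qed
  fix x y assume xy: "(x, y) \<in> \<phi>"
  have "(x \<sqinter> y, y) \<in> \<theta>" "(x \<sqinter> y, x) \<in> \<theta>"
    using step[OF xy] step[of y x] frame_congruenceD(4)[OF \<phi> xy] by (simp_all add: meet_comm[of L y])
  then show "(x, y) \<in> \<theta>" using D(4,5) by metis
qed

lemma frame_congruence_Inter:
  assumes "\<T> \<noteq> {}" "\<And>\<theta>. \<theta> \<in> \<T> \<Longrightarrow> frame_congruence L \<theta>"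
  shows "frame_congruence L (\<Inter>\<T>)"
proof -
  obtain \<theta> where "\<theta> \<in> \<T>" using assms(1) by blast
  note D = frame_congruenceD[OF assms(2)]
  have "(x, y) \<in> carrier L \<times> carrier L" if "(x, y) \<in> \<Inter>\<T>" for x y
    using D(1,2)[OF \<open>\<theta> \<in> \<T>\<close>, of x y] that \<open>\<theta> \<in> \<T>\<close> by blast
  then have "\<Inter>\<T> \<subseteq> carrier L \<times> carrier L"
    by auto
  moreover have "refl_on (carrier L) (\<Inter>\<T>)"
    using D(3) by (auto simp: refl_on_def)
  moreover have "sym (\<Inter>\<T>)"
  proof (intro symI InterI)
    fix x y \<theta> assume "(x, y) \<in> \<Inter>\<T>" "\<theta> \<in> \<T>"
    then show "(y, x) \<in> \<theta>" using D(4)[of \<theta> x y] by auto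
  qed
  moreover have "trans (\<Inter>\<T>)"
  proof (intro transI InterI)
    fix x y z \<theta> assume "(x, y) \<in> \<Inter>\<T>" "(y, z) \<in> \<Inter>\<T>" "\<theta> \<in> \<T>"
    then show "(x, z) \<in> \<theta>" using D(5)[of \<theta> x y z] by auto
  qed
  ultimately have "equiv (carrier L) (\<Inter>\<T>)"
    by (simp add: equiv_def)
  moreover have "\<forall>(x, y)\<in>\<Inter>\<T>. \<forall>(x', y')\<in>\<Inter>\<T>. (x \<sqinter> x', y \<sqinter> y') \<in> \<Inter>\<T>"
    using D(6) by auto
  moreover have "\<forall>R\<subseteq>\<Inter>\<T>. (\<Squnion>(fst ` R), \<Squnion>(snd ` R)) \<in> \<Inter>\<T>"
  proof (intro allI impI InterI)
    fix R \<theta> assume "R \<subseteq> \<Inter>\<T>" "\<theta> \<in> \<T>"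
    then show "(\<Squnion>(fst ` R), \<Squnion>(snd ` R)) \<in> \<theta>" by (intro D(8)) auto
  qed
  ultimately show ?thesis
    by (simp add: frame_congruence_def)
qed

lemma frame_congruence_total: "frame_congruence L (carrier L \<times> carrier L)"
proof -
  have "carrier L \<times> carrier L = {(x, y). x \<in> carrier L \<and> y \<in> carrier L \<and> True \<and> True}"
    by auto
  also have "frame_congruence L \<dots>"
    by (rule frame_congruence_of_preorder) auto
  finally show ?thesis .
qed

lemma frame_congruence_Id_on: "frame_congruence L (Id_on (carrier L))"
proof -
  have "Id_on (carrier L) = {(x, y). x \<in> carrier L \<and> y \<in> carrier L \<and> x \<sqsubseteq> y \<and> y \<sqsubseteq> x}"
    by (auto simp: Id_on_iff dest: le_antisym)
  moreover have "frame_congruence L \<dots>"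
    by (rule frame_congruence_of_preorder) (auto intro: le_trans meet_mono sup_least)
  ultimately show ?thesis by simp
qed

end

section \<open>The congruence biframe\<close>

lemma congruence_biframe_simps [simp]:
  "carrier (congruence_biframe L) = {\<theta>. frame_congruence L \<theta>}"
  "eq (congruence_biframe L) = (=)"
  "le (congruence_biframe L) = (\<subseteq>)"
  "part1 (congruence_biframe L) = nabla L ` carrier L"
  "part2 (congruence_biframe L) = subframe_generated (congruence_frame L) (delta L ` carrier L)"
  by (simp_all add: congruence_biframe_def congruence_frame_def)

text \<open>
  The second part of the congruence biframe is generated within \<^const>\<open>congruence_frame\<close>; as only the
  carrier and the order enter, it is generated within \<^const>\<open>congruence_biframe\<close> too, which is the
  form that the homomorphism lemmas apply to.
\<close>

lemma subframe_congruence_biframe: "subframe (congruence_biframe L) = subframe (congruence_frame L)"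
  by (simp add: fun_eq_iff subframe_def meet_def sup_def inf_def top_def least_def greatest_def
      Upper_def Lower_def congruence_frame_def)

lemma part2_congruence_biframe:
  "part2 (congruence_biframe L) = subframe_generated (congruence_biframe L) (delta L ` carrier L)"
  by (simp add: subframe_generated_def subframe_congruence_biframe)

sublocale frame \<subseteq> cong: complete_lattice "congruence_biframe L"
proof -
  interpret C: partial_order "congruence_biframe L"
    by unfold_locales auto
  show "complete_lattice (congruence_biframe L)"
  proof (rule C.complete_lattice_criterion1)
    have "\<theta> \<subseteq> carrier L \<times> carrier L" if "frame_congruence L \<theta>" for \<theta>
      using frame_congruenceD(1,2)[OF that] by auto
    then show "\<exists>g. greatest (congruence_biframe L) g (carrier (congruence_biframe L))"
      using frame_congruence_total unfolding greatest_def by auto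
  next
    fix \<T> assume "\<T> \<subseteq> carrier (congruence_biframe L)" "\<T> \<noteq> {}"
    then have "greatest (congruence_biframe L) (\<Inter>\<T>) (Lower (congruence_biframe L) \<T>)"
      using frame_congruence_Inter[of \<T>] by (intro greatest_LowerI) (auto simp: Lower_def)
    then show "\<exists>i. greatest (congruence_biframe L) i (Lower (congruence_biframe L) \<T>)" ..
  qed
qed

context frame
begin

lemma top_congruence_biframe: "\<top>\<^bsub>congruence_biframe L\<^esub> = carrier L \<times> carrier L"
proof (rule cong.top_eqI)
  show "\<theta> \<sqsubseteq>\<^bsub>congruence_biframe L\<^esub> carrier L \<times> carrier L"
    if "\<theta> \<in> carrier (congruence_biframe L)" for \<theta>
    using that frame_congruenceD(1,2)[of \<theta>] by auto
qed (simp add: frame_congruence_total)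

lemma bottom_congruence_biframe: "\<bottom>\<^bsub>congruence_biframe L\<^esub> = Id_on (carrier L)"
proof (rule cong.bottom_eqI)
  show "Id_on (carrier L) \<sqsubseteq>\<^bsub>congruence_biframe L\<^esub> \<theta>"
    if "\<theta> \<in> carrier (congruence_biframe L)" for \<theta>
    using that frame_congruenceD(3)[of \<theta>] by auto
qed (simp add: frame_congruence_Id_on)

lemma frame_congruence_Int:
  "frame_congruence L \<theta> \<Longrightarrow> frame_congruence L \<phi> \<Longrightarrow> frame_congruence L (\<theta> \<inter> \<phi>)"
  using frame_congruence_Inter[of "{\<theta>, \<phi>}"] by auto

lemma meet_congruence_biframe:
  assumes "frame_congruence L \<theta>" "frame_congruence L \<phi>"
  shows "\<theta> \<sqinter>\<^bsub>congruence_biframe L\<^esub> \<phi> = \<theta> \<inter> \<phi>"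
  using assms frame_congruence_Int[OF assms] by (intro cong.meet_eqI) auto

lemma frame_congruence_nabla: "a \<in> carrier L \<Longrightarrow> frame_congruence L (nabla L a)"
  by (simp add: nabla_eq_closed_congruence frame_congruence_closed)

lemma frame_congruence_delta: "a \<in> carrier L \<Longrightarrow> frame_congruence L (delta L a)"
  by (simp add: delta_eq_open_congruence frame_congruence_open)

lemma delta_subset_iff:
  assumes "frame_congruence L \<theta>" "a \<in> carrier L"
  shows "delta L a \<subseteq> \<theta> \<longleftrightarrow> (a, \<top>) \<in> \<theta>"
  using assms by (auto simp: delta_def congruence_generated_def)

lemma nabla_delta_complement:
  assumes a: "a \<in> carrier L"
  shows "is_complement (congruence_biframe L) (nabla L a) (delta L a)"
  unfolding is_complement_def
proof (intro conjI)
  note cn = frame_congruence_nabla[OF a] and cd = frame_congruence_delta[OF a]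
  show "nabla L a \<in> carrier (congruence_biframe L)" "delta L a \<in> carrier (congruence_biframe L)"
    using cn cd by simp_all
  have "x \<sqsubseteq> y" if "x \<in> carrier L" "y \<in> carrier L" "x \<sqsubseteq> y \<squnion> a" "x \<sqinter> a \<sqsubseteq> y" for x y
  proof -
    have "(y \<squnion> a) \<sqinter> x \<sqsubseteq> y"
      using that a by (simp add: join_meet_le_iff meet_left meet_comm[of L a])
    then show ?thesis
      using that a by (simp add: meet_comm[of L "y \<squnion> a"] meet_eq_left)
  qed
  then have "nabla L a \<inter> delta L a \<subseteq> Id_on (carrier L)"
    unfolding nabla_eq_closed_congruence[OF a] delta_eq_open_congruence[OF a]
      closed_congruence_def open_congruence_def by (auto simp: Id_on_iff intro!: le_antisym)
  moreover have "Id_on (carrier L) \<subseteq> nabla L a \<inter> delta L a"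
    using frame_congruenceD(3)[OF cn] frame_congruenceD(3)[OF cd] by auto
  ultimately show "nabla L a \<sqinter>\<^bsub>congruence_biframe L\<^esub> delta L a = \<bottom>\<^bsub>congruence_biframe L\<^esub>"
    by (simp add: meet_congruence_biframe cn cd bottom_congruence_biframe)
  let ?j = "nabla L a \<squnion>\<^bsub>congruence_biframe L\<^esub> delta L a"
  have j: "frame_congruence L ?j"
    using cong.join_closed[of "nabla L a" "delta L a"] cn cd by simp
  have "nabla L a \<subseteq> ?j" "delta L a \<subseteq> ?j"
    using cong.join_left[of "nabla L a" "delta L a"] cong.join_right[of "nabla L a" "delta L a"]
      cn cd by simp_all
  then have "(\<bottom>, \<top>) \<in> ?j"
    using frame_congruenceD(5)[OF j] a by (simp add: nabla_subset_iff[OF j] delta_subset_iff[OF j])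
  then have "(\<bottom>, x) \<in> ?j" if "x \<in> carrier L" for x
    using bottom_class_downward[OF j] that by simp
  then have "carrier L \<times> carrier L \<subseteq> ?j"
    by (auto intro: frame_congruenceD(5)[OF j frame_congruenceD(4)[OF j], of \<bottom>])
  moreover have "?j \<subseteq> carrier L \<times> carrier L"
    using frame_congruenceD(1,2)[OF j] by auto
  ultimately show "?j = \<top>\<^bsub>congruence_biframe L\<^esub>"
    by (simp add: top_congruence_biframe)
qed

text \<open>
  If \<open>(x, y)\<close> lies in \<open>\<nabla>\<^sub>b \<inter> \<Delta>\<^sub>a\<close> and \<open>(a, b) \<in> \<theta>\<close>, then \<open>x = (y \<squnion> b) \<sqinter> x\<close> is \<open>\<theta>\<close>-related to
  \<open>(y \<squnion> a) \<sqinter> x = x \<sqinter> y\<close>, and likewise for \<open>y\<close>. Conversely \<open>(x, y) \<in> \<theta>\<close> is obtained from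
  the pairs \<open>(x \<sqinter> y, x)\<close> and \<open>(x \<sqinter> y, y)\<close>, where \<open>(x \<sqinter> y, x)\<close> lies in \<open>\<nabla>\<^sub>x \<inter> \<Delta>\<^bsub>x \<sqinter> y\<^esub>\<close>.
\<close>

lemma congruence_eq_sup:
  assumes \<theta>: "frame_congruence L \<theta>"
  shows "\<theta> = \<Squnion>\<^bsub>congruence_biframe L\<^esub> ((\<lambda>(a, b). nabla L b \<inter> delta L a) ` \<theta>)"
proof (rule cong.sup_eqI[symmetric])
  note D = frame_congruenceD[OF \<theta>]
  show "(\<lambda>(a, b). nabla L b \<inter> delta L a) ` \<theta> \<subseteq> carrier (congruence_biframe L)"
    using D(1,2) by (auto intro!: frame_congruence_Int frame_congruence_nabla frame_congruence_delta)
  show "\<theta> \<in> carrier (congruence_biframe L)" using \<theta> by simp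
next
  note D = frame_congruenceD[OF \<theta>]
  fix \<phi> assume "\<phi> \<in> (\<lambda>(a, b). nabla L b \<inter> delta L a) ` \<theta>"
  then obtain a b where ab: "(a, b) \<in> \<theta>" and \<phi>: "\<phi> = nabla L b \<inter> delta L a" by auto
  then have c: "a \<in> carrier L" "b \<in> carrier L" using D by blast+
  have half: "(x, x \<sqinter> y) \<in> \<theta>"
    if xy: "x \<in> carrier L" "y \<in> carrier L" "x \<sqsubseteq> y \<squnion> b" "x \<sqinter> a \<sqsubseteq> y" for x y
  proof -
    have "((y \<squnion> a) \<sqinter> x, (y \<squnion> b) \<sqinter> x) \<in> \<theta>"
      by (rule D(6)[OF D(7)[OF D(3)[OF xy(2)] ab] D(3)[OF xy(1)]])
    moreover have "(y \<squnion> b) \<sqinter> x = x"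
      using xy c by (simp add: meet_comm[of L _ x] meet_eq_left)
    moreover have "(y \<squnion> a) \<sqinter> x = x \<sqinter> y"
    proof (rule le_antisym)
      show "(y \<squnion> a) \<sqinter> x \<sqsubseteq> x \<sqinter> y"
        using xy c by (simp add: join_meet_le_iff le_meet_iff meet_left meet_right meet_comm[of L a])
      show "x \<sqinter> y \<sqsubseteq> (y \<squnion> a) \<sqinter> x"
        unfolding meet_comm[of L x] using xy c by (intro meet_mono join_left) auto
    qed (use xy c in auto)
    ultimately show ?thesis using D(4) by simp
  qed
  have "(x, y) \<in> \<theta>" if "(x, y) \<in> \<phi>" for x y
  proof -
    have "(x, x \<sqinter> y) \<in> \<theta>" "(y, y \<sqinter> x) \<in> \<theta>"
      using that half c
      by (auto simp: \<phi> nabla_eq_closed_congruence delta_eq_open_congruence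
          closed_congruence_def open_congruence_def)
    then show ?thesis using D(4,5) meet_comm[of L x y] by metis
  qed
  then show "\<phi> \<sqsubseteq>\<^bsub>congruence_biframe L\<^esub> \<theta>" by auto
next
  note D = frame_congruenceD[OF \<theta>]
  fix \<psi> assume "\<psi> \<in> carrier (congruence_biframe L)"
    and ub: "\<And>\<phi>. \<phi> \<in> (\<lambda>(a, b). nabla L b \<inter> delta L a) ` \<theta> \<Longrightarrow> \<phi> \<sqsubseteq>\<^bsub>congruence_biframe L\<^esub> \<psi>"
  then have \<psi>: "frame_congruence L \<psi>" by simp
  have half: "(x \<sqinter> y, x) \<in> \<psi>" if xy: "(x, y) \<in> \<theta>" for x y
  proof -
    have c: "x \<in> carrier L" "y \<in> carrier L" using D(1,2) xy by blast+
    have "(x \<sqinter> x, x \<sqinter> y) \<in> \<theta>" by (rule D(6)[OF D(3)[OF c(1)] xy])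
    then have "(x \<sqinter> y, x) \<in> \<theta>" using D(4) c by (simp add: meet_eq_left)
    then have "nabla L x \<inter> delta L (x \<sqinter> y) \<subseteq> \<psi>"
      using ub by force
    moreover have "(x \<sqinter> y, x) \<in> nabla L x"
      using c by (simp add: nabla_eq_closed_congruence closed_congruence_def join_right)
        (meson le_trans meet_left join_left join_closed meet_closed)
    moreover have "(x \<sqinter> y, x) \<in> delta L (x \<sqinter> y)"
      using c by (simp add: delta_eq_open_congruence open_congruence_def meet_right)
        (meson le_trans meet_left meet_closed)
    ultimately show ?thesis by blast
  qed
  have "(x, y) \<in> \<psi>" if "(x, y) \<in> \<theta>" for x y
    using half[OF that] half[OF D(4)[OF that]] frame_congruenceD(4,5)[OF \<psi>] meet_comm[of L x y]
    by metis
  then show "\<theta> \<sqsubseteq>\<^bsub>congruence_biframe L\<^esub> \<psi>" by auto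
qed

end

section \<open>Homomorphisms\<close>

lemma frame_homD:
  assumes "frame_hom L K f"
  shows "complete_lattice L" "complete_lattice K"
    and "x \<in> carrier L \<Longrightarrow> f x \<in> carrier K"
    and "A \<subseteq> carrier L \<Longrightarrow> f (\<Squnion>\<^bsub>L\<^esub>A) = \<Squnion>\<^bsub>K\<^esub>(f ` A)"
    and "x \<in> carrier L \<Longrightarrow> y \<in> carrier L \<Longrightarrow> f (x \<sqinter>\<^bsub>L\<^esub> y) = f x \<sqinter>\<^bsub>K\<^esub> f y"
    and "x \<in> carrier L \<Longrightarrow> y \<in> carrier L \<Longrightarrow> f (x \<squnion>\<^bsub>L\<^esub> y) = f x \<squnion>\<^bsub>K\<^esub> f y"
    and "f \<top>\<^bsub>L\<^esub> = \<top>\<^bsub>K\<^esub>"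
    and "f \<bottom>\<^bsub>L\<^esub> = \<bottom>\<^bsub>K\<^esub>"
    and "x \<in> carrier L \<Longrightarrow> y \<in> carrier L \<Longrightarrow> x \<sqsubseteq>\<^bsub>L\<^esub> y \<Longrightarrow> f x \<sqsubseteq>\<^bsub>K\<^esub> f y"
proof -
  have f: "f \<in> carrier L \<rightarrow> carrier K" "sup_pres L K f" "meet_pres L K f" "f \<top>\<^bsub>L\<^esub> = \<top>\<^bsub>K\<^esub>"
    using assms by (auto simp: frame_hom_def)
  show L: "complete_lattice L" and K: "complete_lattice K"
    using f(2) by (auto simp: sup_pres_def)
  show "x \<in> carrier L \<Longrightarrow> f x \<in> carrier K" using f(1) by auto
  show sup: "f (\<Squnion>\<^bsub>L\<^esub>A) = \<Squnion>\<^bsub>K\<^esub>(f ` A)" if "A \<subseteq> carrier L" for A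
    using f(2) that by (auto simp: sup_pres_def)
  show "x \<in> carrier L \<Longrightarrow> y \<in> carrier L \<Longrightarrow> f (x \<sqinter>\<^bsub>L\<^esub> y) = f x \<sqinter>\<^bsub>K\<^esub> f y"
    using f(3) by (auto simp: meet_pres_def)
  show "x \<in> carrier L \<Longrightarrow> y \<in> carrier L \<Longrightarrow> f (x \<squnion>\<^bsub>L\<^esub> y) = f x \<squnion>\<^bsub>K\<^esub> f y"
    using sup[of "{x, y}"] by (simp add: join_def)
  show "f \<top>\<^bsub>L\<^esub> = \<top>\<^bsub>K\<^esub>" by (rule f(4))
  show "f \<bottom>\<^bsub>L\<^esub> = \<bottom>\<^bsub>K\<^esub>"
    using sup[of "{}"] by (simp add: complete_lattice.bottom_eq_sup L K)
  show "x \<in> carrier L \<Longrightarrow> y \<in> carrier L \<Longrightarrow> x \<sqsubseteq>\<^bsub>L\<^esub> y \<Longrightarrow> f x \<sqsubseteq>\<^bsub>K\<^esub> f y"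
    using use_iso2[OF meet_pres_isotone[OF f(1,3)]] by blast
qed

lemma frame_homI:
  assumes "complete_lattice L" "complete_lattice K"
    and "\<And>x. x \<in> carrier L \<Longrightarrow> f x \<in> carrier K"
    and "\<And>A. A \<subseteq> carrier L \<Longrightarrow> f (\<Squnion>\<^bsub>L\<^esub>A) = \<Squnion>\<^bsub>K\<^esub>(f ` A)"
    and "\<And>x y. x \<in> carrier L \<Longrightarrow> y \<in> carrier L \<Longrightarrow> f (x \<sqinter>\<^bsub>L\<^esub> y) = f x \<sqinter>\<^bsub>K\<^esub> f y"
    and "f \<top>\<^bsub>L\<^esub> = \<top>\<^bsub>K\<^esub>"
  shows "frame_hom L K f"
  using assms by (auto simp: frame_hom_def sup_pres_def meet_pres_def)

lemma frame_hom_complement: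
  assumes "frame_hom L K f" "is_complement L a b"
  shows "is_complement K (f a) (f b)"
  using frame_homD[OF assms(1)] assms(2) unfolding is_complement_def by metis

lemma frame_hom_subframe_image:
  assumes f: "frame_hom L K f" and S: "subframe L S"
  shows "subframe K (f ` S)"
proof -
  note D = frame_homD[OF f]
  have S': "S \<subseteq> carrier L" "\<top>\<^bsub>L\<^esub> \<in> S" "\<And>x y. x \<in> S \<Longrightarrow> y \<in> S \<Longrightarrow> x \<sqinter>\<^bsub>L\<^esub> y \<in> S"
    "\<And>A. A \<subseteq> S \<Longrightarrow> \<Squnion>\<^bsub>L\<^esub>A \<in> S"
    using S by (auto simp: subframe_def)
  have "f ` S \<subseteq> carrier K" using D(3) S'(1) by auto
  moreover have "\<top>\<^bsub>K\<^esub> \<in> f ` S" using S'(2) D(7) by force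
  moreover have "f x \<sqinter>\<^bsub>K\<^esub> f y \<in> f ` S" if "x \<in> S" "y \<in> S" for x y
    using D(5)[of x y] S'(1,3) that by (metis imageI subsetD)
  moreover have "\<Squnion>\<^bsub>K\<^esub>B \<in> f ` S" if "B \<subseteq> f ` S" for B
  proof -
    obtain A where A: "A \<subseteq> S" "B = f ` A" using \<open>B \<subseteq> f ` S\<close> unfolding subset_image_iff by blast
    then have "\<Squnion>\<^bsub>K\<^esub>B = f (\<Squnion>\<^bsub>L\<^esub>A)" using D(4)[of A] S'(1) by auto
    then show ?thesis using S'(4)[OF A(1)] by simp
  qed
  ultimately show ?thesis by (auto simp: subframe_def)
qed

lemma frame_hom_subframe_vimage:
  assumes f: "frame_hom L K f" and S: "subframe K S"
  shows "subframe L {x \<in> carrier L. f x \<in> S}"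
proof -
  note D = frame_homD[OF f]
  interpret L: complete_lattice L by (rule D(1))
  have S': "\<top>\<^bsub>K\<^esub> \<in> S" "\<And>x y. x \<in> S \<Longrightarrow> y \<in> S \<Longrightarrow> x \<sqinter>\<^bsub>K\<^esub> y \<in> S"
    "\<And>A. A \<subseteq> S \<Longrightarrow> \<Squnion>\<^bsub>K\<^esub>A \<in> S"
    using S by (auto simp: subframe_def)
  have "\<Squnion>\<^bsub>L\<^esub>A \<in> carrier L \<and> f (\<Squnion>\<^bsub>L\<^esub>A) \<in> S" if "A \<subseteq> {x \<in> carrier L. f x \<in> S}" for A
  proof -
    have "A \<subseteq> carrier L" "f ` A \<subseteq> S" using that by auto
    then show ?thesis using D(4)[of A] S'(3) by simp
  qed
  then show ?thesis
    using D(5,7) S' by (auto simp: subframe_def)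
qed

lemma biframe_iso_sym:
  assumes "biframe_iso M N f"
  shows "biframe_isomorphic N M"
  using assms unfolding biframe_iso_def biframe_isomorphic_def by blast

lemma biframe_isoI:
  assumes f: "biframe_hom M N f" and inj: "inj_on f (carrier M)" and surj: "f ` carrier M = carrier N"
    and parts: "part1 N \<subseteq> f ` part1 M" "part2 N \<subseteq> f ` part2 M"
    and sub: "part1 M \<subseteq> carrier M" "part2 M \<subseteq> carrier M"
  shows "biframe_iso M N f"
proof -
  have fh: "frame_hom M N f" using f by (simp add: biframe_hom_def)
  note D = frame_homD[OF fh]
  interpret M: complete_lattice M by (rule D(1))
  interpret N: complete_lattice N by (rule D(2))
  define g where "g = inv_into (carrier M) f"
  have gf: "g (f x) = x" if "x \<in> carrier M" for x
    using that inj by (simp add: g_def)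
  have fg: "f (g y) = y" and gc: "g y \<in> carrier M" if "y \<in> carrier N" for y
    using that surj by (auto simp: g_def f_inv_into_f inv_into_into)
  have "frame_hom N M g"
  proof (rule frame_homI)
    fix A assume A: "A \<subseteq> carrier N"
    then have gA: "g ` A \<subseteq> carrier M" and "f ` g ` A = A"
      using gc fg by (auto simp: image_iff subset_iff)
    then have "g (\<Squnion>\<^bsub>N\<^esub>A) = g (f (\<Squnion>\<^bsub>M\<^esub>(g ` A)))"
      using D(4)[OF gA] by simp
    then show "g (\<Squnion>\<^bsub>N\<^esub>A) = \<Squnion>\<^bsub>M\<^esub>(g ` A)"
      using gA by (simp add: gf)
  next
    fix x y assume "x \<in> carrier N" "y \<in> carrier N"
    then show "g (x \<sqinter>\<^bsub>N\<^esub> y) = g x \<sqinter>\<^bsub>M\<^esub> g y"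
      using D(5)[of "g x" "g y"] gf[of "g x \<sqinter>\<^bsub>M\<^esub> g y"] by (simp add: fg gc)
  next
    show "g \<top>\<^bsub>N\<^esub> = \<top>\<^bsub>M\<^esub>" using gf[of "\<top>\<^bsub>M\<^esub>"] D(7) by simp
  qed (use gc M.complete_lattice_axioms N.complete_lattice_axioms in auto)
  moreover have "g ` T \<subseteq> S" if "T \<subseteq> f ` S" "S \<subseteq> carrier M" for S T
    using that gf by (auto simp: subset_iff image_iff)
  ultimately show ?thesis
    using f gf fg parts sub unfolding biframe_iso_def biframe_hom_def by metis
qed

section \<open>Closed elements and closure in a biframe\<close>

lemma closed_frame_simps [simp]:
  "carrier (closed_frame M) = part1 M"
  "eq (closed_frame M) = eq M"
  "le (closed_frame M) = le M"
  by (simp_all add: closed_frame_def)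

context biframe
begin

lemma part1D:
  shows "x \<in> part1 M \<Longrightarrow> x \<in> carrier M"
    and "A \<subseteq> part1 M \<Longrightarrow> A \<subseteq> carrier M"
    and "\<top> \<in> part1 M"
    and "x \<in> part1 M \<Longrightarrow> y \<in> part1 M \<Longrightarrow> x \<sqinter> y \<in> part1 M"
    and "A \<subseteq> part1 M \<Longrightarrow> \<Squnion>A \<in> part1 M"
  using subframe_part1 by (auto simp: subframe_def)

lemma complete_lattice_closed_frame: "complete_lattice (closed_frame M)"
proof -
  interpret K: partial_order "closed_frame M"
    using part1D(1) by unfold_locales (auto intro: le_trans simp: eq_is_equal)
  show ?thesis
  proof (rule K.complete_latticeI)
    fix A assume "A \<subseteq> carrier (closed_frame M)"
    then have A: "A \<subseteq> part1 M" by simp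
    have "least (closed_frame M) (\<Squnion>A) (Upper (closed_frame M) A)"
    proof (rule least_UpperI)
      show "x \<sqsubseteq>\<^bsub>closed_frame M\<^esub> \<Squnion>A" if "x \<in> A" for x
        using that part1D(2)[OF A] by (simp add: sup_upper)
      show "\<Squnion>A \<sqsubseteq>\<^bsub>closed_frame M\<^esub> y" if "y \<in> Upper (closed_frame M) A" for y
        using that A part1D(1) by (auto simp: Upper_def intro!: sup_least)
    qed (use A part1D(5) in auto)
    then show "\<exists>s. least (closed_frame M) s (Upper (closed_frame M) A)" ..
    let ?B = "{x \<in> part1 M. \<forall>y\<in>A. x \<sqsubseteq> y}"
    have B: "?B \<subseteq> part1 M" by auto
    have "greatest (closed_frame M) (\<Squnion>?B) (Lower (closed_frame M) A)"
    proof (rule greatest_LowerI)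
      show "\<Squnion>?B \<sqsubseteq>\<^bsub>closed_frame M\<^esub> x" if "x \<in> A" for x
        using that A part1D(1) by (auto intro!: sup_least)
      show "y \<sqsubseteq>\<^bsub>closed_frame M\<^esub> \<Squnion>?B" if "y \<in> Lower (closed_frame M) A" for y
        using that A part1D(2)[OF B] by (auto simp: Lower_def intro!: sup_upper)
    qed (use A part1D(5)[OF B] in auto)
    then show "\<exists>s. greatest (closed_frame M) s (Lower (closed_frame M) A)" ..
  qed
qed

lemma closed_frame_ops:
  shows closed_sup: "A \<subseteq> part1 M \<Longrightarrow> \<Squnion>\<^bsub>closed_frame M\<^esub>A = \<Squnion>A"
    and closed_meet: "x \<in> part1 M \<Longrightarrow> y \<in> part1 M \<Longrightarrow> x \<sqinter>\<^bsub>closed_frame M\<^esub> y = x \<sqinter> y"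
    and closed_join: "x \<in> part1 M \<Longrightarrow> y \<in> part1 M \<Longrightarrow> x \<squnion>\<^bsub>closed_frame M\<^esub> y = x \<squnion> y"
    and closed_bottom: "\<bottom>\<^bsub>closed_frame M\<^esub> = \<bottom>"
proof -
  interpret K: complete_lattice "closed_frame M" by (rule complete_lattice_closed_frame)
  show sup: "\<Squnion>\<^bsub>closed_frame M\<^esub>A = \<Squnion>A" if "A \<subseteq> part1 M" for A
  proof (rule K.sup_eqI)
    show "\<And>x. x \<in> A \<Longrightarrow> x \<sqsubseteq>\<^bsub>closed_frame M\<^esub> \<Squnion>A"
      using part1D(2)[OF that] by (simp add: sup_upper)
    show "\<And>u. u \<in> carrier (closed_frame M) \<Longrightarrow> (\<And>x. x \<in> A \<Longrightarrow> x \<sqsubseteq>\<^bsub>closed_frame M\<^esub> u) \<Longrightarrow>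
        \<Squnion>A \<sqsubseteq>\<^bsub>closed_frame M\<^esub> u"
      using part1D(1) part1D(2)[OF that] by (simp add: sup_least)
  qed (use that part1D(5) in auto)
  show "x \<squnion>\<^bsub>closed_frame M\<^esub> y = x \<squnion> y" if "x \<in> part1 M" "y \<in> part1 M"
    using sup[of "{x, y}"] that by (simp add: join_def)
  show "\<bottom>\<^bsub>closed_frame M\<^esub> = \<bottom>"
    using sup[of "{}"] by (simp add: K.bottom_eq_sup bottom_eq_sup)
  show "x \<sqinter>\<^bsub>closed_frame M\<^esub> y = x \<sqinter> y" if "x \<in> part1 M" "y \<in> part1 M"
    using that part1D(1,4) by (intro K.meet_eqI) (auto simp: le_meet_iff meet_left meet_right)
qed

lemma join_part1: "x \<in> part1 M \<Longrightarrow> y \<in> part1 M \<Longrightarrow> x \<squnion> y \<in> part1 M"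
  using part1D(5)[of "{x, y}"] by (simp add: join_def)

lemma bottom_part1: "\<bottom> \<in> part1 M"
  using part1D(5)[of "{}"] by (simp add: bottom_eq_sup)

end

sublocale biframe \<subseteq> closed: frame "closed_frame M"
proof (rule frame.intro)
  show "complete_lattice (closed_frame M)" by (rule complete_lattice_closed_frame)
  show "frame_axioms (closed_frame M)"
  proof
    fix x A assume "x \<in> carrier (closed_frame M)" "A \<subseteq> carrier (closed_frame M)"
    then have x: "x \<in> part1 M" and A: "A \<subseteq> part1 M" by auto
    have img: "(\<lambda>a. x \<sqinter>\<^bsub>closed_frame M\<^esub> a) ` A = (\<lambda>a. x \<sqinter> a) ` A"
      using x A by (intro image_cong) (auto simp: closed_meet)
    have "(\<lambda>a. x \<sqinter> a) ` A \<subseteq> part1 M"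
      using x A part1D(4) by auto
    then show "x \<sqinter>\<^bsub>closed_frame M\<^esub> (\<Squnion>\<^bsub>closed_frame M\<^esub>A) =
        \<Squnion>\<^bsub>closed_frame M\<^esub>((\<lambda>a. x \<sqinter>\<^bsub>closed_frame M\<^esub> a) ` A)"
      unfolding img using x A part1D(5)[OF A] meet_sup_distrib[OF part1D(1)[OF x] part1D(2)[OF A]]
      by (simp add: closed_sup closed_meet)
  qed
qed

context biframe
begin

lemma cl_greatest:
  assumes a: "a \<in> carrier M"
  shows "greatest M (cl M a) {x \<in> part1 M. x \<sqsubseteq> a}"
proof -
  let ?B = "{x \<in> part1 M. x \<sqsubseteq> a}"
  have B: "?B \<subseteq> part1 M" by auto
  have "greatest M (\<Squnion>?B) ?B"
    unfolding greatest_def using part1D(2,5)[OF B] a by (auto intro: sup_upper intro!: sup_least)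
  then show ?thesis
    unfolding cl_def by (rule theI) (use \<open>greatest M (\<Squnion>?B) ?B\<close> greatest_unique in blast)
qed

lemma cl_closed: "a \<in> carrier M \<Longrightarrow> cl M a \<in> part1 M"
  using cl_greatest[of a] by (auto simp: greatest_def)

lemma cl_below: "a \<in> carrier M \<Longrightarrow> cl M a \<sqsubseteq> a"
  using cl_greatest[of a] by (auto simp: greatest_def)

lemma le_cl_iff: "a \<in> carrier M \<Longrightarrow> x \<in> part1 M \<Longrightarrow> x \<sqsubseteq> cl M a \<longleftrightarrow> x \<sqsubseteq> a"
  using cl_greatest[of a] cl_below[of a] cl_closed[of a] part1D(1) le_trans[of x "cl M a" a]
  by (auto simp: greatest_def)

lemma cl_eqI:
  assumes "a \<in> carrier M" "c \<in> part1 M" "\<And>x. x \<in> part1 M \<Longrightarrow> x \<sqsubseteq> a \<longleftrightarrow> x \<sqsubseteq> c"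
  shows "cl M a = c"
proof (rule le_antisym)
  show "cl M a \<sqsubseteq> c" "c \<sqsubseteq> cl M a"
    using assms cl_closed[of a] cl_below[of a] part1D(1)[of c] by (auto simp: le_cl_iff)
qed (use assms cl_closed part1D(1) in auto)

lemma clear_closed: "clear M b \<Longrightarrow> b \<in> carrier M"
  by (auto simp: clear_def greatest_def)

lemma clear_greatest: "clear M b \<Longrightarrow> c \<in> carrier M \<Longrightarrow> cl M c = cl M b \<Longrightarrow> c \<sqsubseteq> b"
  by (auto simp: clear_def greatest_def)

end

section \<open>The congruential coreflection\<close>

context strictly_zero_dimensional_biframe
begin

text \<open>
  The kernel of the map \<open>x \<mapsto> x \<squnion> m\<close> from the closed elements to the frame of elements above \<open>m\<close>.
\<close>

definition trace :: "'a \<Rightarrow> 'a rel" where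
  "trace m = {(x, y). x \<in> part1 M \<and> y \<in> part1 M \<and> x \<sqsubseteq> y \<squnion> m \<and> y \<sqsubseteq> x \<squnion> m}"

text \<open>
  The abstraction is restricted to the carrier, so that the function is extensional, as the
  definite description \<^const>\<open>congruential_coreflection\<close> requires.
\<close>

definition coreflection :: "'a rel \<Rightarrow> 'a" where
  "coreflection = (\<lambda>\<theta>\<in>carrier (congruence_biframe (closed_frame M)).
     \<Squnion>{b \<sqinter> a' | a b a'. (a, b) \<in> \<theta> \<and> is_complement M a a'})"

lemma frame_congruence_trace:
  assumes m: "m \<in> carrier M"
  shows "frame_congruence (closed_frame M) (trace m)"
proof -
  have t: "trace m = closed_congruence m \<inter> part1 M \<times> part1 M"
    using part1D(1) by (auto simp: trace_def closed_congruence_def)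
  note D = frame_congruenceD[OF frame_congruence_closed[OF m]]
  have "equiv (part1 M) (trace m)"
    using D(3,4,5) part1D(1) unfolding t equiv_def refl_on_def sym_def trans_def by blast
  moreover have "\<forall>(x, y)\<in>trace m. \<forall>(x', y')\<in>trace m.
      (x \<sqinter>\<^bsub>closed_frame M\<^esub> x', y \<sqinter>\<^bsub>closed_frame M\<^esub> y') \<in> trace m"
    using D(6) part1D(4) by (auto simp: t closed_meet)
  moreover have "\<forall>R\<subseteq>trace m. (\<Squnion>\<^bsub>closed_frame M\<^esub>(fst ` R), \<Squnion>\<^bsub>closed_frame M\<^esub>(snd ` R)) \<in> trace m"
  proof (intro allI impI)
    fix R assume R: "R \<subseteq> trace m"
    then have p: "fst ` R \<subseteq> part1 M" "snd ` R \<subseteq> part1 M"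
      by (auto simp: t)
    have "(\<Squnion>(fst ` R), \<Squnion>(snd ` R)) \<in> closed_congruence m"
      using R by (intro D(8)) (auto simp: t)
    then show "(\<Squnion>\<^bsub>closed_frame M\<^esub>(fst ` R), \<Squnion>\<^bsub>closed_frame M\<^esub>(snd ` R)) \<in> trace m"
      using p part1D(5) by (simp add: t closed_sup)
  qed
  ultimately show ?thesis
    by (simp add: frame_congruence_def)
qed

lemma coreflection_set_closed:
  assumes "frame_congruence (closed_frame M) \<theta>"
  shows "{b \<sqinter> a' | a b a'. (a, b) \<in> \<theta> \<and> is_complement M a a'} \<subseteq> carrier M"
  using closed.frame_congruenceD(2)[OF assms] part1D(1) by (auto simp: is_complement_def)

lemma coreflection_closed:
  "frame_congruence (closed_frame M) \<theta> \<Longrightarrow> coreflection \<theta> \<in> carrier M"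
  using coreflection_set_closed by (simp add: coreflection_def)

text \<open>
  The adjunction behind everything else: it makes \<^const>\<open>coreflection\<close> preserve joins and reduces
  each inequality below an element of \<open>M\<close> to an inclusion of congruences.
\<close>

lemma coreflection_le_iff:
  assumes \<theta>: "frame_congruence (closed_frame M) \<theta>" and m: "m \<in> carrier M"
  shows "coreflection \<theta> \<sqsubseteq> m \<longleftrightarrow> \<theta> \<subseteq> trace m"
proof -
  note D = closed.frame_congruenceD[OF \<theta>, simplified]
  have "coreflection \<theta> \<sqsubseteq> m \<longleftrightarrow> (\<forall>a b a'. (a, b) \<in> \<theta> \<longrightarrow> is_complement M a a' \<longrightarrow> b \<sqinter> a' \<sqsubseteq> m)"
    using \<theta> sup_le_iff[OF coreflection_set_closed[OF \<theta>] m]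
    by (simp add: coreflection_def) blast
  also have "\<dots> \<longleftrightarrow> (\<forall>a b. (a, b) \<in> \<theta> \<longrightarrow> b \<sqsubseteq> a \<squnion> m)"
    using complement_shunt[OF _ _ m] part1_complemented D(1,2) part1D(1) by metis
  also have "\<dots> \<longleftrightarrow> \<theta> \<subseteq> trace m"
    using D(1,2,4) unfolding trace_def by blast
  finally show ?thesis .
qed

lemma coreflection_eqI:
  assumes "frame_congruence (closed_frame M) \<theta>" "x \<in> carrier M"
    and "\<And>m. m \<in> carrier M \<Longrightarrow> \<theta> \<subseteq> trace m \<longleftrightarrow> x \<sqsubseteq> m"
  shows "coreflection \<theta> = x"
proof (rule le_antisym)
  note c = coreflection_closed[OF assms(1)]
  show "coreflection \<theta> \<sqsubseteq> x"
    using assms(2,3) by (simp add: coreflection_le_iff[OF assms(1)])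
  show "x \<sqsubseteq> coreflection \<theta>"
    using assms(3)[OF c] c by (simp add: coreflection_le_iff[OF assms(1) c, symmetric])
qed (use assms(2) coreflection_closed[OF assms(1)] in auto)

lemma coreflection_nabla:
  assumes a: "a \<in> part1 M"
  shows "coreflection (nabla (closed_frame M) a) = a"
proof (rule coreflection_eqI)
  show "frame_congruence (closed_frame M) (nabla (closed_frame M) a)"
    using a by (simp add: closed.frame_congruence_nabla)
  show "a \<in> carrier M" using a by (rule part1D(1))
  fix m assume m: "m \<in> carrier M"
  have "\<bottom> \<squnion> m = m" using m by (intro le_antisym) (simp_all add: join_le_iff join_right)
  then have "(\<bottom>, a) \<in> trace m \<longleftrightarrow> a \<sqsubseteq> m"
    using a m part1D(1)[OF a] bottom_part1 by (simp add: trace_def)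
  then show "nabla (closed_frame M) a \<subseteq> trace m \<longleftrightarrow> a \<sqsubseteq> m"
    using closed.nabla_subset_iff[OF frame_congruence_trace[OF m], of a] a
    by (simp add: closed_bottom)
qed

lemma coreflection_sup:
  assumes T: "\<T> \<subseteq> carrier (congruence_biframe (closed_frame M))"
  shows "coreflection (\<Squnion>\<^bsub>congruence_biframe (closed_frame M)\<^esub>\<T>) = \<Squnion>(coreflection ` \<T>)"
proof (rule coreflection_eqI)
  show "frame_congruence (closed_frame M) (\<Squnion>\<^bsub>congruence_biframe (closed_frame M)\<^esub>\<T>)"
    using closed.cong.sup_closed[OF T] by simp
  have im: "coreflection ` \<T> \<subseteq> carrier M"
    using T coreflection_closed by auto
  then show "\<Squnion>(coreflection ` \<T>) \<in> carrier M" by simp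
  fix m assume m: "m \<in> carrier M"
  show "\<Squnion>\<^bsub>congruence_biframe (closed_frame M)\<^esub>\<T> \<subseteq> trace m \<longleftrightarrow> \<Squnion>(coreflection ` \<T>) \<sqsubseteq> m"
    using closed.cong.sup_le_iff[OF T, of "trace m"] sup_le_iff[OF im m] T
    by (auto simp: frame_congruence_trace m coreflection_le_iff subset_iff[of \<T>])
qed

text \<open>
  By distributivity the claim concerns \<open>w = (b \<sqinter> a\<^sup>c) \<sqinter> (d \<sqinter> c\<^sup>c)\<close> with \<open>(a, b) \<in> \<theta>\<close> and
  \<open>(c, d) \<in> \<phi>\<close>. The pair \<open>((a \<squnion> c) \<sqinter> b \<sqinter> d, b \<sqinter> d)\<close> lies in both congruences: replace \<open>a\<close> by \<open>b\<close>
  using \<open>\<theta>\<close>, or \<open>c\<close> by \<open>d\<close> using \<open>\<phi>\<close>, and absorb. As \<open>w\<close> lies below \<open>b \<sqinter> d\<close> and is disjoint from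
  \<open>a \<squnion> c\<close>, it lies below the image of \<open>\<theta> \<inter> \<phi>\<close>.
\<close>

lemma coreflection_meet:
  assumes \<theta>: "frame_congruence (closed_frame M) \<theta>" and \<phi>: "frame_congruence (closed_frame M) \<phi>"
  shows "coreflection (\<theta> \<inter> \<phi>) = coreflection \<theta> \<sqinter> coreflection \<phi>"
proof (rule le_antisym)
  have i: "frame_congruence (closed_frame M) (\<theta> \<inter> \<phi>)"
    using closed.frame_congruence_Int[OF \<theta> \<phi>] .
  let ?m = "coreflection (\<theta> \<inter> \<phi>)"
  have c: "coreflection \<theta> \<in> carrier M" "coreflection \<phi> \<in> carrier M" and m: "?m \<in> carrier M"
    using coreflection_closed \<theta> \<phi> i by auto
  then show "?m \<in> carrier M" "coreflection \<theta> \<sqinter> coreflection \<phi> \<in> carrier M"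
    by auto
  have "\<theta> \<subseteq> trace (coreflection \<theta>)" "\<phi> \<subseteq> trace (coreflection \<phi>)"
    using coreflection_le_iff[OF \<theta> c(1)] coreflection_le_iff[OF \<phi> c(2)] c by auto
  then show "?m \<sqsubseteq> coreflection \<theta> \<sqinter> coreflection \<phi>"
    unfolding le_meet_iff[OF c m] coreflection_le_iff[OF i c(1)] coreflection_le_iff[OF i c(2)]
    by blast
  have im: "\<theta> \<inter> \<phi> \<subseteq> trace ?m"
    using coreflection_le_iff[OF i m] m by simp
  note T = closed.frame_congruenceD[OF \<theta>, simplified]
  note P = closed.frame_congruenceD[OF \<phi>, simplified]
  have key: "b \<sqinter> a' \<sqinter> (d \<sqinter> c') \<sqsubseteq> ?m"
    if ab: "(a, b) \<in> \<theta>" "is_complement M a a'" and cd: "(c, d) \<in> \<phi>" "is_complement M c c'"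
    for a b a' c d c'
  proof -
    have p: "a \<in> part1 M" "b \<in> part1 M" "c \<in> part1 M" "d \<in> part1 M"
      using T(1,2)[OF ab(1)] P(1,2)[OF cd(1)] by auto
    have pc: "a \<in> carrier M" "b \<in> carrier M" "c \<in> carrier M" "d \<in> carrier M"
      "a' \<in> carrier M" "c' \<in> carrier M" "a \<sqinter> a' = \<bottom>" "c \<sqinter> c' = \<bottom>"
      using p part1D(1) ab cd by (auto simp: is_complement_def)
    let ?q = "b \<sqinter> d" and ?w = "b \<sqinter> a' \<sqinter> (d \<sqinter> c')"
    have q: "?q \<in> part1 M" and ac: "a \<squnion> c \<in> part1 M"
      using p part1D(4) join_part1 by auto
    have absorb: "(x \<squnion> y) \<sqinter> ?q = ?q" if "x \<in> carrier M" "y \<in> carrier M" "?q \<sqsubseteq> x \<or> ?q \<sqsubseteq> y" for x y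
    proof -
      have "?q \<sqsubseteq> x \<squnion> y"
        using that pc join_left[of x y] join_right[of x y] by (meson le_trans meet_closed join_closed)
      then show ?thesis using that pc by (simp add: meet_comm[of M "x \<squnion> y"] meet_eq_left)
    qed
    have "((a \<squnion> c) \<sqinter> ?q, (b \<squnion> c) \<sqinter> ?q) \<in> \<theta>"
      using T(6)[OF T(7)[OF ab(1) T(3)[OF p(3)]] T(3)[OF q]] p q join_part1
      by (simp add: closed_join closed_meet)
    moreover have "((a \<squnion> c) \<sqinter> ?q, (a \<squnion> d) \<sqinter> ?q) \<in> \<phi>"
      using P(6)[OF P(7)[OF P(3)[OF p(1)] cd(1)] P(3)[OF q]] p q join_part1
      by (simp add: closed_join closed_meet)
    ultimately have "((a \<squnion> c) \<sqinter> ?q, ?q) \<in> trace ?m"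
      using im absorb[of b c] absorb[of a d] pc meet_left[of b d] meet_right[of b d] by auto
    then have "?q \<sqsubseteq> (a \<squnion> c) \<sqinter> ?q \<squnion> ?m" by (simp add: trace_def)
    moreover have wq: "?w \<sqsubseteq> ?q"
      using pc by (intro meet_mono meet_left) auto
    moreover have "(a \<squnion> c) \<sqinter> ?q \<squnion> ?m \<sqsubseteq> (a \<squnion> c) \<squnion> ?m"
      using pc m by (simp add: join_le_iff join_right) (meson le_trans meet_left join_left join_closed meet_closed)
    ultimately have "?w \<sqsubseteq> (a \<squnion> c) \<squnion> ?m"
      using pc m by (meson le_trans meet_closed join_closed)
    then have "?w = ((a \<squnion> c) \<squnion> ?m) \<sqinter> ?w"
      using pc m by (simp add: meet_comm[of M "a \<squnion> c \<squnion> ?m"] meet_eq_left)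
    moreover have "((a \<squnion> c) \<squnion> ?m) \<sqinter> ?w \<sqsubseteq> ?m"
    proof -
      have wa: "?w \<sqsubseteq> a'" "?w \<sqsubseteq> c'"
        using pc by (meson le_trans meet_left meet_right meet_closed)+
      have "a \<sqinter> ?w \<sqsubseteq> a \<sqinter> a'" "c \<sqinter> ?w \<sqsubseteq> c \<sqinter> c'"
        by (intro meet_mono; use wa pc in simp)+
      then have "a \<sqinter> ?w \<sqsubseteq> ?m" "c \<sqinter> ?w \<sqsubseteq> ?m"
        using pc m le_trans[OF _ bottom_lower[OF m]] by simp_all
      then show ?thesis
        using pc m by (simp add: join_meet_le_iff meet_left)
    qed
    ultimately show ?thesis by simp
  qed
  let ?X = "\<lambda>\<theta>. {b \<sqinter> a' | a b a'. (a, b) \<in> \<theta> \<and> is_complement M a a'}"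
  have X: "?X \<theta> \<subseteq> carrier M" "?X \<phi> \<subseteq> carrier M"
    using coreflection_set_closed \<theta> \<phi> by auto
  have "x \<sqinter> coreflection \<phi> \<sqsubseteq> ?m" if x: "x \<in> ?X \<theta>" for x
  proof -
    have xc: "x \<in> carrier M" using X(1) x by (rule subsetD)
    have "y \<sqinter> x \<sqsubseteq> ?m" if "y \<in> ?X \<phi>" for y
      using that x key by (auto simp: meet_comm[of M y])
    then have "\<Squnion>(?X \<phi>) \<sqinter> x \<sqsubseteq> ?m"
      by (intro iffD2[OF sup_meet_le_iff[OF X(2) xc m]] ballI)
    then show ?thesis
      using \<phi> by (simp add: coreflection_def meet_comm[of M x])
  qed
  then have "\<Squnion>(?X \<theta>) \<sqinter> coreflection \<phi> \<sqsubseteq> ?m"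
    by (intro iffD2[OF sup_meet_le_iff[OF X(1) c(2) m]] ballI)
  then show "coreflection \<theta> \<sqinter> coreflection \<phi> \<sqsubseteq> ?m"
    using \<theta> by (simp add: coreflection_def)
qed

lemma frame_hom_coreflection:
  "frame_hom (congruence_biframe (closed_frame M)) M coreflection"
proof (rule frame_homI)
  show "complete_lattice (congruence_biframe (closed_frame M))" "complete_lattice M"
    by unfold_locales
  have "nabla (closed_frame M) \<top> = \<top>\<^bsub>congruence_biframe (closed_frame M)\<^esub>"
  proof (rule closed.cong.top_eqI[symmetric])
    fix \<theta> assume "\<theta> \<in> carrier (congruence_biframe (closed_frame M))"
    then show "\<theta> \<sqsubseteq>\<^bsub>congruence_biframe (closed_frame M)\<^esub> nabla (closed_frame M) \<top>"
      using closed.frame_congruenceD(1,2)[of \<theta>] part1D(1,3)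
      by (auto simp: closed.nabla_eq_closed_congruence closed.closed_congruence_def closed_join)
        (meson le_trans top_higher join_right join_closed top_closed)+
  qed (simp add: closed.frame_congruence_nabla part1D(3))
  then show "coreflection \<top>\<^bsub>congruence_biframe (closed_frame M)\<^esub> = \<top>"
    using coreflection_nabla[OF part1D(3)] by simp
qed (auto simp: coreflection_closed coreflection_sup closed.meet_congruence_biframe coreflection_meet)

lemma complement_in_part2:
  assumes "a \<in> part1 M" "is_complement M a b"
  shows "b \<in> part2 M"
  using part1_complemented[OF assms(1)] complement_unique[OF assms(2)] by blast

lemma hom_delta_complement:
  assumes f: "frame_hom (congruence_biframe (closed_frame M)) M f"
    and nabla: "\<And>a. a \<in> part1 M \<Longrightarrow> f (nabla (closed_frame M) a) = a" and a: "a \<in> part1 M"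
  shows "is_complement M a (f (delta (closed_frame M) a))"
  using frame_hom_complement[OF f closed.nabla_delta_complement[of a]] nabla[OF a] a by simp

text \<open>
  A homomorphism with the prescribed values on \<open>\<nabla>\<^sub>b\<close> must send \<open>\<Delta>\<^sub>a\<close> to the unique complement of
  \<open>a\<close>, so \<open>congruence_eq_sup\<close> turns its value at \<open>\<theta>\<close> into the join that defines
  \<^const>\<open>coreflection\<close>.
\<close>

lemma hom_eq_coreflection:
  assumes f: "frame_hom (congruence_biframe (closed_frame M)) M f"
    and nabla: "\<And>a. a \<in> part1 M \<Longrightarrow> f (nabla (closed_frame M) a) = a"
    and \<theta>: "frame_congruence (closed_frame M) \<theta>"
  shows "f \<theta> = coreflection \<theta>"
proof -
  let ?g = "\<lambda>(a, b). nabla (closed_frame M) b \<inter> delta (closed_frame M) a"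
  note D = closed.frame_congruenceD[OF \<theta>, simplified]
  have g: "?g ` \<theta> \<subseteq> carrier (congruence_biframe (closed_frame M))"
    using D(1,2) by (auto intro!: closed.frame_congruence_Int closed.frame_congruence_nabla
        closed.frame_congruence_delta)
  have val: "f (?g (a, b)) = b \<sqinter> a'" if ab: "(a, b) \<in> \<theta>" "is_complement M a a'" for a b a'
  proof -
    have p: "a \<in> part1 M" "b \<in> part1 M" using D(1,2)[OF ab(1)] by auto
    have "f (?g (a, b)) = b \<sqinter> f (delta (closed_frame M) a)"
      using frame_homD(5)[OF f, of "nabla (closed_frame M) b" "delta (closed_frame M) a"] p
      by (simp add: closed.frame_congruence_nabla closed.frame_congruence_delta
          closed.meet_congruence_biframe nabla)
    then show ?thesis
      using complement_unique[OF hom_delta_complement[OF f nabla p(1)] ab(2)] by simp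
  qed
  have "f ` ?g ` \<theta> = {b \<sqinter> a' | a b a'. (a, b) \<in> \<theta> \<and> is_complement M a a'}" (is "?A = ?B")
  proof
    show "?A \<subseteq> ?B"
    proof
      fix x assume "x \<in> ?A"
      then obtain a b where ab: "(a, b) \<in> \<theta>" "x = f (?g (a, b))" by auto
      obtain a' where "is_complement M a a'" using part1_complemented D(1)[OF ab(1)] by blast
      then show "x \<in> ?B" using val[OF ab(1)] ab by blast
    qed
    show "?B \<subseteq> ?A"
    proof
      fix x assume "x \<in> ?B"
      then obtain a b a' where ab: "(a, b) \<in> \<theta>" "is_complement M a a'" "x = b \<sqinter> a'" by blast
      then have "x = f (?g (a, b))" using val by metis
      then show "x \<in> ?A" using ab(1) by blast
    qed
  qed
  then have "\<Squnion>(f ` ?g ` \<theta>) = coreflection \<theta>"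
    using \<theta> by (simp add: coreflection_def)
  moreover have "f \<theta> = f (\<Squnion>\<^bsub>congruence_biframe (closed_frame M)\<^esub>(?g ` \<theta>))"
    using closed.congruence_eq_sup[OF \<theta>] by simp
  ultimately show ?thesis
    using frame_homD(4)[OF f g] by simp
qed

lemma coreflection_delta:
  "a \<in> part1 M \<Longrightarrow> is_complement M a (coreflection (delta (closed_frame M) a))"
  using hom_delta_complement[OF frame_hom_coreflection coreflection_nabla] .

lemma subframe_part2_congruence:
  "subframe (congruence_biframe (closed_frame M)) (part2 (congruence_biframe (closed_frame M)))"
  unfolding part2_congruence_biframe
  by (rule closed.cong.subframe_subframe_generated) (auto simp: closed.frame_congruence_delta)

lemma biframe_hom_coreflection:
  "biframe_hom (congruence_biframe (closed_frame M)) M coreflection"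
proof -
  let ?S = "{\<theta> \<in> carrier (congruence_biframe (closed_frame M)). coreflection \<theta> \<in> part2 M}"
  have "part2 (congruence_biframe (closed_frame M)) \<subseteq> ?S"
    unfolding part2_congruence_biframe
  proof (rule subframe_generated_least)
    show "subframe (congruence_biframe (closed_frame M)) ?S"
      by (rule frame_hom_subframe_vimage[OF frame_hom_coreflection subframe_part2])
    show "delta (closed_frame M) ` carrier (closed_frame M) \<subseteq> ?S"
      using complement_in_part2[OF _ coreflection_delta] by (auto simp: closed.frame_congruence_delta)
  qed
  then show ?thesis
    unfolding biframe_hom_def using frame_hom_coreflection coreflection_nabla by auto
qed

lemma congruential_coreflection_eq: "congruential_coreflection M = coreflection"
  unfolding congruential_coreflection_def
proof (rule the_equality)
  show "coreflection \<in> extensional (carrier (congruence_biframe (closed_frame M))) \<and>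
      biframe_hom (congruence_biframe (closed_frame M)) M coreflection \<and>
      (\<forall>a\<in>part1 M. coreflection (nabla (closed_frame M) a) = a)"
    using biframe_hom_coreflection coreflection_nabla by (simp add: coreflection_def)
next
  fix f
  assume f: "f \<in> extensional (carrier (congruence_biframe (closed_frame M))) \<and>
      biframe_hom (congruence_biframe (closed_frame M)) M f \<and>
      (\<forall>a\<in>part1 M. f (nabla (closed_frame M) a) = a)"
  show "f = coreflection"
  proof (rule extensionalityI)
    show "f \<theta> = coreflection \<theta>" if "\<theta> \<in> carrier (congruence_biframe (closed_frame M))" for \<theta>
      using f that by (intro hom_eq_coreflection) (auto simp: biframe_hom_def)
  qed (use f in \<open>auto simp: coreflection_def\<close>)
qed

lemma coreflection_surj:
  shows "part2 M \<subseteq> coreflection ` part2 (congruence_biframe (closed_frame M))"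
    and "coreflection ` carrier (congruence_biframe (closed_frame M)) = carrier M"
proof -
  let ?C = "congruence_biframe (closed_frame M)"
  have "subframe M (coreflection ` part2 ?C)"
    by (rule frame_hom_subframe_image[OF frame_hom_coreflection subframe_part2_congruence])
  moreover have "b \<in> coreflection ` part2 ?C" if "a \<in> part1 M" "is_complement M a b" for a b
  proof -
    have "b = coreflection (delta (closed_frame M) a)"
      using complement_unique[OF that(2) coreflection_delta[OF that(1)]] .
    moreover have "delta (closed_frame M) a \<in> part2 ?C"
      using subframe_generated_base[of "delta (closed_frame M) ` part1 M" ?C] that(1)
      unfolding part2_congruence_biframe by auto
    ultimately show ?thesis by blast
  qed
  ultimately show p2: "part2 M \<subseteq> coreflection ` part2 ?C"
    unfolding part2_generated by (intro subframe_generated_least) auto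
  have "subframe M (coreflection ` carrier ?C)"
    by (rule frame_hom_subframe_image[OF frame_hom_coreflection closed.cong.subframe_carrier])
  moreover have "part1 M \<subseteq> coreflection ` carrier ?C"
  proof
    fix a assume "a \<in> part1 M"
    then show "a \<in> coreflection ` carrier ?C"
      using coreflection_nabla[of a] closed.frame_congruence_nabla[of a] by (intro image_eqI) auto
  qed
  moreover have "part2 ?C \<subseteq> carrier ?C"
    using subframe_part2_congruence unfolding subframe_def by blast
  then have "part2 M \<subseteq> coreflection ` carrier ?C"
    using p2 by blast
  ultimately have "carrier M \<subseteq> coreflection ` carrier ?C"
    unfolding parts_generate[symmetric] by (intro subframe_generated_least Un_least)
  then show "coreflection ` carrier ?C = carrier M"
    using coreflection_closed by auto
qed

text \<open>
  From left to right only \<open>cl c = a\<close> matters: closed elements below \<open>c\<close> lie below \<open>a\<close>. From right to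
  left, let \<open>(x, y) \<in> \<theta>\<close>. Then \<open>c \<squnion> (y \<sqinter> x\<^sup>c)\<close> still has closure \<open>a\<close>: if a closed \<open>z\<close> lies below it,
  then \<open>z \<sqinter> x \<sqsubseteq> c\<close>, so \<open>z \<sqinter> x \<sqsubseteq> a\<close>, hence \<open>z \<sqinter> y \<sqsubseteq> a\<close> by the definition of the dense congruence,
  and so \<open>z \<sqsubseteq> c \<squnion> (z \<sqinter> y) = c\<close>. As \<open>c\<close> is clear, \<open>y \<sqinter> x\<^sup>c \<sqsubseteq> c\<close>.
\<close>

lemma coreflection_le_clear_iff:
  assumes c: "clear M c" and \<theta>: "frame_congruence (closed_frame M) \<theta>"
  shows "coreflection \<theta> \<sqsubseteq> c \<longleftrightarrow> \<theta> \<subseteq> closed.dense_congruence (cl M c)"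
proof -
  have cc: "c \<in> carrier M" using c by (rule clear_closed)
  have a: "cl M c \<in> part1 M" "cl M c \<in> carrier M" "cl M c \<sqsubseteq> c"
    using cc cl_closed cl_below part1D(1) by auto
  note D = closed.frame_congruenceD[OF \<theta>, simplified]
  show ?thesis
    unfolding coreflection_le_iff[OF \<theta> cc]
  proof
    assume sub: "\<theta> \<subseteq> trace c"
    show "\<theta> \<subseteq> closed.dense_congruence (cl M c)"
    proof (rule closed.subset_dense_congruenceI[OF \<theta>])
      fix p q assume pq: "(p, q) \<in> \<theta>" and "q \<sqsubseteq>\<^bsub>closed_frame M\<^esub> cl M c"
      then have q: "q \<sqsubseteq> cl M c" by simp
      have p: "p \<in> part1 M" "q \<in> part1 M" using D(1,2)[OF pq] by auto
      have "p \<sqsubseteq> q \<squnion> c" using sub pq by (auto simp: trace_def)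
      moreover have "q \<squnion> c \<sqsubseteq> c"
        using q p part1D(1) cc by (simp add: join_le_iff le_cl_iff)
      ultimately have "p \<sqsubseteq> c" using p part1D(1) cc by (meson le_trans join_closed)
      then show "p \<sqsubseteq>\<^bsub>closed_frame M\<^esub> cl M c" using p cc by (simp add: le_cl_iff)
    qed (use a in simp)
  next
    assume sub: "\<theta> \<subseteq> closed.dense_congruence (cl M c)"
    have half: "y \<sqsubseteq> x \<squnion> c" if xy: "(x, y) \<in> \<theta>" for x y
    proof -
      have p: "x \<in> part1 M" "y \<in> part1 M" using D(1,2)[OF xy] by auto
      then have pc: "x \<in> carrier M" "y \<in> carrier M" using part1D(1) by auto
      obtain x' where x': "is_complement M x x'" using part1_complemented[OF p(1)] by blast
      then have x'c: "x' \<in> carrier M" "x \<sqinter> x' = \<bottom>" by (auto simp: is_complement_def)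
      let ?e = "c \<squnion> y \<sqinter> x'"
      have ec: "?e \<in> carrier M" using pc x'c cc by simp
      have "cl M ?e = cl M c"
      proof (rule cl_eqI[OF ec a(1)])
        fix z assume z: "z \<in> part1 M"
        then have zc: "z \<in> carrier M" by (rule part1D(1))
        show "z \<sqsubseteq> ?e \<longleftrightarrow> z \<sqsubseteq> cl M c"
        proof
          assume "z \<sqsubseteq> cl M c"
          then show "z \<sqsubseteq> ?e"
            using a ec zc pc x'c cc le_trans[OF _ join_left[of c "y \<sqinter> x'"], of z]
            by (simp add: le_cl_iff z)
        next
          assume ze: "z \<sqsubseteq> ?e"
          have "y \<sqinter> x' \<sqinter> x \<sqsubseteq> \<bottom>"
            using pc x'c meet_right[of y \<bottom>] by (simp add: meet_assoc meet_comm[of M x'])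
          then have "?e \<sqinter> x \<sqsubseteq> c"
            using pc x'c cc le_trans[OF _ bottom_lower[OF cc]] by (simp add: join_meet_le_iff meet_left)
          moreover have "z \<sqinter> x \<sqsubseteq> ?e \<sqinter> x"
            using ze zc ec pc by (intro meet_mono) auto
          ultimately have "x \<sqinter> z \<sqsubseteq> c"
            using zc ec pc cc unfolding meet_comm[of M x] by (meson le_trans meet_closed)
          then have "x \<sqinter> z \<sqsubseteq> cl M c"
            using z p part1D(4) cc by (simp add: le_cl_iff)
          moreover have "(x, y) \<in> closed.dense_congruence (cl M c)"
            using sub xy by (rule subsetD)
          ultimately have "y \<sqinter> z \<sqsubseteq> cl M c"
            using z p by (simp add: closed.dense_congruence_def closed_meet)
          then have yz: "y \<sqinter> z \<sqsubseteq> c"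
            using z p part1D(4) cc by (simp add: le_cl_iff)
          have "y \<sqinter> x' \<sqinter> z \<sqsubseteq> y \<sqinter> z"
            using pc x'c zc by (intro meet_mono meet_left) auto
          then have "y \<sqinter> x' \<sqinter> z \<sqsubseteq> c"
            using yz pc x'c zc cc by (meson le_trans meet_closed)
          then have "?e \<sqinter> z \<sqsubseteq> c"
            using pc x'c cc zc by (simp add: join_meet_le_iff meet_left)
          moreover have "?e \<sqinter> z = z"
            using ze zc ec by (simp add: meet_comm[of M ?e] meet_eq_left)
          ultimately show "z \<sqsubseteq> cl M c"
            using z cc by (simp add: le_cl_iff)
        qed
      qed
      then have "?e \<sqsubseteq> c" using clear_greatest[OF c ec] by simp
      then have "y \<sqinter> x' \<sqsubseteq> c" using pc x'c cc by (simp add: join_le_iff)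
      then show ?thesis using complement_shunt[OF x' pc(2) cc] by simp
    qed
    then show "\<theta> \<subseteq> trace c"
      using D(1,2,4) unfolding trace_def by blast
  qed
qed

theorem biframe_iso_coreflection:
  assumes clear: "no_missing_clear_elements M"
  shows "biframe_iso (congruence_biframe (closed_frame M)) M coreflection"
proof (rule biframe_isoI[OF biframe_hom_coreflection])
  have le: "\<phi> \<subseteq> \<theta>"
    if "frame_congruence (closed_frame M) \<theta>" "frame_congruence (closed_frame M) \<phi>"
      "coreflection \<theta> = coreflection \<phi>" for \<theta> \<phi>
  proof (rule closed.dense_congruences_separate[OF that(1,2)])
    fix a assume "a \<in> carrier (closed_frame M)" and sub: "\<theta> \<subseteq> closed.dense_congruence a"
    then obtain c where c: "clear M c" "cl M c = a"
      using clear by (auto simp: no_missing_clear_elements_def)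
    then show "\<phi> \<subseteq> closed.dense_congruence a"
      using coreflection_le_clear_iff[OF c(1) that(1)] coreflection_le_clear_iff[OF c(1) that(2)]
        sub that(3) by simp
  qed
  show "inj_on coreflection (carrier (congruence_biframe (closed_frame M)))"
  proof (rule inj_onI)
    fix \<theta> \<phi>
    assume "\<theta> \<in> carrier (congruence_biframe (closed_frame M))"
      "\<phi> \<in> carrier (congruence_biframe (closed_frame M))" "coreflection \<theta> = coreflection \<phi>"
    then show "\<theta> = \<phi>" using le[of \<theta> \<phi>] le[of \<phi> \<theta>] by simp
  qed
  show "coreflection ` carrier (congruence_biframe (closed_frame M)) = carrier M"
    by (rule coreflection_surj)
  show "part2 M \<subseteq> coreflection ` part2 (congruence_biframe (closed_frame M))"
    by (rule coreflection_surj)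
  show "part1 M \<subseteq> coreflection ` part1 (congruence_biframe (closed_frame M))"
  proof
    fix a assume a: "a \<in> part1 M"
    then have "nabla (closed_frame M) a \<in> part1 (congruence_biframe (closed_frame M))" by simp
    then show "a \<in> coreflection ` part1 (congruence_biframe (closed_frame M))"
      by (rule image_eqI[rotated]) (simp add: coreflection_nabla[OF a])
  qed
  show "part1 (congruence_biframe (closed_frame M)) \<subseteq> carrier (congruence_biframe (closed_frame M))"
    by (auto simp: closed.frame_congruence_nabla)
  show "part2 (congruence_biframe (closed_frame M)) \<subseteq> carrier (congruence_biframe (closed_frame M))"
    using subframe_part2_congruence unfolding subframe_def by blast
qed

end

section \<open>Clear elements of congruence biframes\<close>

text \<open>
  The clear element with closure \<open>a\<close> is the preimage of \<open>dense_congruence u\<close>, where \<open>a\<close> corresponds to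
  \<open>\<nabla>\<^sub>u\<close>. A congruence with closure \<open>\<nabla>\<^sub>u\<close> relates \<open>\<bottom>\<close> to exactly the elements below \<open>u\<close>; these then
  form a single class, so it is contained in \<open>dense_congruence u\<close>.
\<close>

lemma isomorphic_congruence_biframe_clear:
  assumes M: "biframe M" and L: "frame L"
    and iso: "biframe_isomorphic M (congruence_biframe L)"
  shows "no_missing_clear_elements M"
  unfolding no_missing_clear_elements_def
proof
  interpret M: biframe M by (rule M)
  interpret L: frame L by (rule L)
  let ?C = "congruence_biframe L"
  obtain f g where f: "biframe_hom M ?C f" and g: "biframe_hom ?C M g"
    and gf: "\<And>x. x \<in> carrier M \<Longrightarrow> g (f x) = x" and fg: "\<And>\<theta>. \<theta> \<in> carrier ?C \<Longrightarrow> f (g \<theta>) = \<theta>"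
    using iso by (auto simp: biframe_isomorphic_def biframe_iso_def)
  have fh: "frame_hom M ?C f" and gh: "frame_hom ?C M g"
    using f g by (auto simp: biframe_hom_def)
  have fc: "frame_congruence L (f x)" if "x \<in> carrier M" for x
    using frame_homD(3)[OF fh that] by simp
  have gc: "g \<theta> \<in> carrier M" if "frame_congruence L \<theta>" for \<theta>
    using frame_homD(3)[OF gh] that by simp
  have le_iff: "x \<sqsubseteq>\<^bsub>M\<^esub> y \<longleftrightarrow> f x \<subseteq> f y" if "x \<in> carrier M" "y \<in> carrier M" for x y
    using frame_homD(9)[OF fh, of x y] frame_homD(9)[OF gh, of "f x" "f y"] that fc gf by auto
  have f1: "\<exists>w\<in>carrier L. f z = nabla L w" if "z \<in> part1 M" for z
  proof -
    have "f ` part1 M \<subseteq> nabla L ` carrier L" using f by (simp add: biframe_hom_def)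
    then show ?thesis using that by blast
  qed
  have g1: "g (nabla L w) \<in> part1 M" if "w \<in> carrier L" for w
  proof -
    have "g ` nabla L ` carrier L \<subseteq> part1 M" using g by (simp add: biframe_hom_def)
    then show ?thesis using that by blast
  qed
  fix a assume a: "a \<in> part1 M"
  then have ac: "a \<in> carrier M" by (rule M.part1D(1))
  obtain u where u: "u \<in> carrier L" "f a = nabla L u" using f1[OF a] by blast
  let ?d = "L.dense_congruence u"
  have d: "frame_congruence L ?d" using u by (simp add: L.frame_congruence_dense)
  have clc: "cl M (g ?d) = a"
  proof (rule M.cl_eqI[OF gc[OF d] a])
    fix z assume z: "z \<in> part1 M"
    obtain w where w: "w \<in> carrier L" "f z = nabla L w" using f1[OF z] by blast
    have "z \<sqsubseteq>\<^bsub>M\<^esub> g ?d \<longleftrightarrow> w \<sqsubseteq>\<^bsub>L\<^esub> u"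
      using le_iff[of z "g ?d"] gc[OF d] M.part1D(1)[OF z] d w u
      by (simp add: fg L.nabla_subset_iff L.bottom_dense_congruence_iff)
    moreover have "z \<sqsubseteq>\<^bsub>M\<^esub> a \<longleftrightarrow> w \<sqsubseteq>\<^bsub>L\<^esub> u"
      using le_iff[of z a] ac M.part1D(1)[OF z] w u by (simp add: L.nabla_subset_nabla_iff)
    ultimately show "z \<sqsubseteq>\<^bsub>M\<^esub> g ?d \<longleftrightarrow> z \<sqsubseteq>\<^bsub>M\<^esub> a" by simp
  qed
  have "b \<sqsubseteq>\<^bsub>M\<^esub> g ?d" if b: "b \<in> carrier M" "cl M b = a" for b
  proof -
    have \<theta>: "frame_congruence L (f b)" using fc[OF b(1)] .
    note D = L.frame_congruenceD[OF \<theta>]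
    have closure: "(\<bottom>\<^bsub>L\<^esub>, w) \<in> f b \<longleftrightarrow> w \<sqsubseteq>\<^bsub>L\<^esub> u" if w: "w \<in> carrier L" for w
    proof -
      have n: "frame_congruence L (nabla L w)" using w by (rule L.frame_congruence_nabla)
      have "(\<bottom>\<^bsub>L\<^esub>, w) \<in> f b \<longleftrightarrow> g (nabla L w) \<sqsubseteq>\<^bsub>M\<^esub> b"
        using le_iff[OF gc[OF n] b(1)] n w \<theta> by (simp add: fg L.nabla_subset_iff)
      also have "\<dots> \<longleftrightarrow> g (nabla L w) \<sqsubseteq>\<^bsub>M\<^esub> a"
        using M.le_cl_iff[OF b(1) g1[OF w]] b(2) by simp
      also have "\<dots> \<longleftrightarrow> w \<sqsubseteq>\<^bsub>L\<^esub> u"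
        using le_iff[OF gc[OF n] ac] n w u by (simp add: fg L.nabla_subset_nabla_iff)
      finally show ?thesis .
    qed
    have "f b \<subseteq> ?d"
    proof (rule L.subset_dense_congruenceI[OF \<theta> u(1)])
      fix p q assume pq: "(p, q) \<in> f b" "q \<sqsubseteq>\<^bsub>L\<^esub> u"
      then have "(\<bottom>\<^bsub>L\<^esub>, q) \<in> f b" using closure D(2) by blast
      then have "(\<bottom>\<^bsub>L\<^esub>, p) \<in> f b" using D(4)[OF pq(1)] D(5) by blast
      then show "p \<sqsubseteq>\<^bsub>L\<^esub> u" using closure D(1)[OF pq(1)] by blast
    qed
    then show ?thesis
      using le_iff[OF b(1) gc[OF d]] d by (simp add: fg)
  qed
  then have "clear M (g ?d)"
    unfolding clear_def greatest_def using gc[OF d] clc by auto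
  then show "\<exists>b. clear M b \<and> cl M b = a" using clc by blast
qed

theorem mainTheorem16:
  fixes M :: "'a biframe"
  assumes "strictly_zero_dimensional_biframe M"
  shows "(congruential M \<longleftrightarrow> no_missing_clear_elements M) \<and>
    (biframe_iso (congruence_biframe (closed_frame M)) M (congruential_coreflection M)
       \<longleftrightarrow> no_missing_clear_elements M) \<and>
    (\<forall>L :: 'b gorder. frame L \<and> biframe_isomorphic M (congruence_biframe L)
       \<longrightarrow> no_missing_clear_elements M)"
proof -
  interpret strictly_zero_dimensional_biframe M by (rule assms)
  have M: "biframe M" by unfold_locales
  have K: "frame (closed_frame M)" by unfold_locales
  have iso: "biframe_iso (congruence_biframe (closed_frame M)) M (congruential_coreflection M)
      \<longleftrightarrow> no_missing_clear_elements M"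
    using biframe_iso_coreflection isomorphic_congruence_biframe_clear[OF M K biframe_iso_sym]
    by (auto simp: congruential_coreflection_eq)
  moreover have "congruential M \<longleftrightarrow> no_missing_clear_elements M"
    unfolding congruential_def
    using isomorphic_congruence_biframe_clear[OF M] K biframe_iso_sym iso by blast
  ultimately show ?thesis
    using isomorphic_congruence_biframe_clear[OF M] by blast
qed

end
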